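(* Let $\Omega\subset\mathbb{R}^n$ ($n>2$) be a bounded smooth domain, $s\in[0,2]$, $p\in(2,\tfrac{2n}{n-2})$, $u_0\in H_0^1(\Omega)$, and let $u$ be a weak solution of (P) on its maximal existence interval $[0,T)$, satisfying (E2). Suppose $u$ blows up in finite time $T$ in the sense that $\lim_{t\to T^-}\Big(\int_\Omega\frac{u^2}{|x|^s}dx+\|\nabla u\|_2^2\Big)=\infty$. Then $$T\ge \frac{1}{C_*^p(p-2)}\Big(\int_\Omega\frac{u_0^2}{|x|^s}dx+\|\nabla u_0\|_2^2\Big)^{\frac{2-p}{2}},$$ and for all $t\in[0,T)$, $$\int_\Omega\frac{u(t)^2}{|x|^s}dx+\|\nabla u(t)\|_2^2\ \ge\ \frac{1}{C_*^{\frac{2p}{p-2}}(p-2)^{\frac{2}{p-2}}}\,(T-t)^{-\frac{2}{p-2}}.$$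
   Context: Problem (P): $\dfrac{u_t}{|x|^s}-\Delta u-\Delta u_t=|u|^{p-2}u$ in $\Omega\times(0,\infty)$, $u=0$ on $\partial\Omega\times(0,\infty)$, $u(x,0)=u_0(x)$ in $\Omega$. A weak solution on $\Omega\times[0,T)$ is a function $u\in L^\infty(0,T;H_0^1(\Omega))$ with $u_t\in L^2(0,T;H_0^1(\Omega))$, $u(\cdot,0)=u_0$, such that for a.e. $t\in(0,T)$ and every $\phi\in H_0^1(\Omega)$: $(|x|^{-s}u_t,\phi)+(\nabla u,\nabla\phi)+(\nabla u_t,\nabla\phi)=(|u|^{p-2}u,\phi)$, where $(\cdot,\cdot)$ is the $L^2(\Omega)$ inner product and $\|\cdot\|_q$ the $L^q(\Omega)$ norm; $T$ is the maximal existence time. $I(\varphi)=\|\nabla\varphi\|_2^2-\|\varphi\|_p^p$ for $\varphi\in H_0^1(\Omega)$. $C_*>0$ is the best constant with $\|\varphi\|_p\le C_*\|\nabla\varphi\|_2$ for all $\varphi\in H_0^1(\Omega)$. Standing fact (E2): for $t\in[0,T)$, $\frac12\frac{d}{dt}\Big(\int_\Omega\frac{u^2}{|x|^s}dx+\|\nabla u\|_2^2\Big)=-I(u(t))$. *)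

theory Defs
  imports "HOL-Analysis.Analysis"
begin

fun Ck_on :: "nat \<Rightarrow> (real^'n::finite) set \<Rightarrow> (real^'n \<Rightarrow> real) \<Rightarrow> bool" where
  "Ck_on 0 S f = continuous_on S f"
| "Ck_on (Suc k) S f = (\<exists>Df :: real^'n \<Rightarrow> real^'n.
      (\<forall>x\<in>S. (f has_derivative (\<lambda>h. Df x \<bullet> h)) (at x)) \<and>
      (\<forall>i. Ck_on k S (\<lambda>x. Df x $ i)))"

definition smooth_on :: "(real^'n::finite) set \<Rightarrow> (real^'n \<Rightarrow> real) \<Rightarrow> bool" where
  "smooth_on S f \<longleftrightarrow> (\<forall>k. Ck_on k S f)"

definition bounded_smooth_domain :: "(real^'n::finite) set \<Rightarrow> bool" where
  "bounded_smooth_domain \<Omega> \<longleftrightarrow> open \<Omega> \<and> bounded \<Omega> \<and> connected \<Omega> \<and> \<Omega> \<noteq> {} \<and>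
     (\<forall>z\<in>frontier \<Omega>. \<exists>r>0. \<exists>\<psi> D\<psi>. smooth_on UNIV \<psi> \<and>
        (\<forall>x. (\<psi> has_derivative (\<lambda>h. D\<psi> x \<bullet> h)) (at x)) \<and>
        (\<forall>x\<in>ball z r. D\<psi> x \<noteq> 0) \<and>
        \<Omega> \<inter> ball z r = {x\<in>ball z r. \<psi> x < 0})"

definition is_test :: "(real^'n::finite) set \<Rightarrow> (real^'n \<Rightarrow> real) \<Rightarrow> (real^'n \<Rightarrow> real^'n) \<Rightarrow> bool" where
  "is_test \<Omega> \<phi> D\<phi> \<longleftrightarrow> (\<forall>x. (\<phi> has_derivative (\<lambda>h. D\<phi> x \<bullet> h)) (at x)) \<and>
      continuous_on UNIV D\<phi> \<and> compact (closure {x. \<phi> x \<noteq> 0}) \<and>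
      closure {x. \<phi> x \<noteq> 0} \<subseteq> \<Omega>"

definition L2 :: "(real^'n::finite) set \<Rightarrow> (real^'n \<Rightarrow> real) \<Rightarrow> bool" where
  "L2 \<Omega> f \<longleftrightarrow> f \<in> borel_measurable lborel \<and> set_integrable lborel \<Omega> (\<lambda>x. (f x)\<^sup>2)"

definition L2v :: "(real^'n::finite) set \<Rightarrow> (real^'n \<Rightarrow> real^'n) \<Rightarrow> bool" where
  "L2v \<Omega> g \<longleftrightarrow> g \<in> borel_measurable lborel \<and> set_integrable lborel \<Omega> (\<lambda>x. (norm (g x))\<^sup>2)"

definition weak_grad :: "(real^'n::finite) set \<Rightarrow> (real^'n \<Rightarrow> real) \<Rightarrow> (real^'n \<Rightarrow> real^'n) \<Rightarrow> bool" where
  "weak_grad \<Omega> u g \<longleftrightarrow> (\<forall>\<phi> D\<phi>. is_test \<Omega> \<phi> D\<phi> \<longrightarrow>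
      (LINT x:\<Omega>|lborel. u x *\<^sub>R D\<phi> x) = - (LINT x:\<Omega>|lborel. \<phi> x *\<^sub>R g x))"

definition H01 :: "(real^'n::finite) set \<Rightarrow> (real^'n \<Rightarrow> real) \<Rightarrow> bool" where
  "H01 \<Omega> u \<longleftrightarrow> L2 \<Omega> u \<and> (\<exists>g. L2v \<Omega> g \<and> weak_grad \<Omega> u g \<and>
      (\<forall>\<epsilon>>0. \<exists>\<phi> D\<phi>. is_test \<Omega> \<phi> D\<phi> \<and>
         (LINT x:\<Omega>|lborel. (u x - \<phi> x)\<^sup>2 + (norm (g x - D\<phi> x))\<^sup>2) < \<epsilon>))"

text \<open>The (a.e. unique) weak gradient.\<close>
definition wgrad :: "(real^'n::finite) set \<Rightarrow> (real^'n \<Rightarrow> real) \<Rightarrow> real^'n \<Rightarrow> real^'n" where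
  "wgrad \<Omega> u = (SOME g. L2v \<Omega> g \<and> weak_grad \<Omega> u g)"

definition grad_norm2 :: "(real^'n::finite) set \<Rightarrow> (real^'n \<Rightarrow> real) \<Rightarrow> real" where
  "grad_norm2 \<Omega> u = (LINT x:\<Omega>|lborel. (norm (wgrad \<Omega> u x))\<^sup>2)"

definition Lp_norm :: "(real^'n::finite) set \<Rightarrow> real \<Rightarrow> (real^'n \<Rightarrow> real) \<Rightarrow> real" where
  "Lp_norm \<Omega> q u = (LINT x:\<Omega>|lborel. \<bar>u x\<bar> powr q) powr (1 / q)"

definition wL2 :: "(real^'n::finite) set \<Rightarrow> real \<Rightarrow> (real^'n \<Rightarrow> real) \<Rightarrow> real" where
  "wL2 \<Omega> s u = (LINT x:\<Omega>|lborel. (u x)\<^sup>2 / norm x powr s)"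

definition Ifun :: "(real^'n::finite) set \<Rightarrow> real \<Rightarrow> (real^'n \<Rightarrow> real) \<Rightarrow> real" where
  "Ifun \<Omega> p \<phi> = grad_norm2 \<Omega> \<phi> - Lp_norm \<Omega> p \<phi> powr p"

definition Cstar :: "(real^'n::finite) set \<Rightarrow> real \<Rightarrow> real" where
  "Cstar \<Omega> p = Inf {C. C \<ge> 0 \<and> (\<forall>\<phi>. H01 \<Omega> \<phi> \<longrightarrow> Lp_norm \<Omega> p \<phi> \<le> C * sqrt (grad_norm2 \<Omega> \<phi>))}"

definition weak_sol_with :: "(real^'n::finite) set \<Rightarrow> real \<Rightarrow> real \<Rightarrow> (real^'n \<Rightarrow> real) \<Rightarrow> real
    \<Rightarrow> (real \<Rightarrow> real^'n \<Rightarrow> real) \<Rightarrow> (real \<Rightarrow> real^'n \<Rightarrow> real) \<Rightarrow> bool" where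
  "weak_sol_with \<Omega> s p u0 T u ut \<longleftrightarrow>
     (\<forall>t\<in>{0..<T}. H01 \<Omega> (u t)) \<and>
     (\<forall>T'\<in>{0..<T}. \<exists>B. AE t in lborel. t \<in> {0..T'} \<longrightarrow>
          (LINT x:\<Omega>|lborel. (u t x)\<^sup>2) + grad_norm2 \<Omega> (u t) \<le> B) \<and>
     (AE t in lborel. t \<in> {0<..<T} \<longrightarrow> H01 \<Omega> (ut t)) \<and>
     (\<lambda>(t, x). ut t x) \<in> borel_measurable (lborel \<Otimes>\<^sub>M lborel) \<and>
     (\<forall>T'\<in>{0..<T}. set_integrable lborel {0..T'}
          (\<lambda>t. (LINT x:\<Omega>|lborel. (ut t x)\<^sup>2) + grad_norm2 \<Omega> (ut t))) \<and>
     (\<forall>t\<in>{0..<T}. AE x in lborel. x \<in> \<Omega> \<longrightarrow>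
          u t x = u0 x + (LINT \<tau>:{0..t}|lborel. ut \<tau> x)) \<and>
     (AE x in lborel. x \<in> \<Omega> \<longrightarrow> u 0 x = u0 x) \<and>
     (AE t in lborel. t \<in> {0<..<T} \<longrightarrow> (\<forall>\<phi>. H01 \<Omega> \<phi> \<longrightarrow>
          (LINT x:\<Omega>|lborel. ut t x * \<phi> x / norm x powr s)
          + (LINT x:\<Omega>|lborel. wgrad \<Omega> (u t) x \<bullet> wgrad \<Omega> \<phi> x)
          + (LINT x:\<Omega>|lborel. wgrad \<Omega> (ut t) x \<bullet> wgrad \<Omega> \<phi> x)
          = (LINT x:\<Omega>|lborel. \<bar>u t x\<bar> powr (p - 2) * u t x * \<phi> x)))"

definition weak_sol :: "(real^'n::finite) set \<Rightarrow> real \<Rightarrow> real \<Rightarrow> (real^'n \<Rightarrow> real) \<Rightarrow> real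
    \<Rightarrow> (real \<Rightarrow> real^'n \<Rightarrow> real) \<Rightarrow> bool" where
  "weak_sol \<Omega> s p u0 T u \<longleftrightarrow> (\<exists>ut. weak_sol_with \<Omega> s p u0 T u ut)"

definition maximal_weak_sol :: "(real^'n::finite) set \<Rightarrow> real \<Rightarrow> real \<Rightarrow> (real^'n \<Rightarrow> real) \<Rightarrow> real
    \<Rightarrow> (real \<Rightarrow> real^'n \<Rightarrow> real) \<Rightarrow> bool" where
  "maximal_weak_sol \<Omega> s p u0 T u \<longleftrightarrow> weak_sol \<Omega> s p u0 T u \<and>
     \<not> (\<exists>T' > T. \<exists>v. weak_sol \<Omega> s p u0 T' v \<and> (\<forall>t\<in>{0..<T}. v t = u t))"

definition energy :: "(real^'n::finite) set \<Rightarrow> real \<Rightarrow> (real^'n \<Rightarrow> real) \<Rightarrow> real" where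
  "energy \<Omega> s v = wL2 \<Omega> s v + grad_norm2 \<Omega> v"

end

theory Submission
  imports Defs
begin

text \<open>
  Write \<open>E(t)\<close> for the energy. By (E2) and the definition of \<open>C\<^sub>*\<close>,
  \<open>E' = -2 I(u) \<le> 2 C\<^sub>*\<^sup>p E\<close> to the power \<open>p/2\<close>, so \<open>E\<close> to the power \<open>(2-p)/2\<close> plus \<open>C\<^sub>*\<^sup>p (p-2) t\<close> is
  nondecreasing; it tends to \<open>C\<^sub>*\<^sup>p (p-2) T\<close> at the blow-up time, which gives both bounds.

  The definition of \<open>C\<^sub>*\<close> as an infimum is meaningful only if some constant is admissible, which is the
  subcritical Sobolev inequality. For \<open>C\<^sup>1\<close> functions of bounded support it is obtained by integrating
  \<open>\<nabla>f\<close> along rays, averaging over a ball of directions and using Young's inequality with weights that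
  are powers of the ray parameter; Fatou's lemma extends it to \<open>H\<^sub>0\<^sup>1\<close>. Since the gradient norm is
  defined through a choice of weak gradient, its almost everywhere uniqueness is needed as well.
\<close>

section \<open>Functions detecting integrable densities\<close>

text \<open>\<open>H01\<close> approximates some weak gradient \<open>g\<close> by gradients of test
  functions, whereas \<open>grad_norm2\<close> uses the one picked by \<open>SOME\<close>;
  uniqueness almost everywhere joins the two. Test functions are only C^1, so uniqueness is proved
  with C^1 weights that turn a test function into another test function when multiplied with it, and
  no smoothing by convolution occurs. In the Sobolev estimate the averaged ray integral gives y(x)
  <= \<sigma>^(1-p) X(x) + \<sigma> K0 for every \<sigma> > 0, where y is |f| up to a constant
  factor, X has a bounded integral and K0 is independent of x. Taking \<sigma> proportional to y(x)
  turns this into y^p <= const X pointwise, and integrating over x yields the L^p bound without any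
  estimate for a singular convolution kernel.\<close>

definition C1_fun :: "(real^'n::finite \<Rightarrow> real) \<Rightarrow> (real^'n \<Rightarrow> real^'n) \<Rightarrow> bool" where
  "C1_fun f Df \<longleftrightarrow> (\<forall>x. (f has_derivative (\<lambda>h. Df x \<bullet> h)) (at x)) \<and> continuous_on UNIV Df"

lemma C1_fun_continuous: "C1_fun f Df \<Longrightarrow> continuous_on UNIV f"
  unfolding C1_fun_def
  by (meson continuous_at_imp_continuous_on has_derivative_continuous)

lemma C1_fun_mult:
  assumes "C1_fun f Df" "C1_fun g Dg"
  shows "C1_fun (\<lambda>x. f x * g x) (\<lambda>x. f x *\<^sub>R Dg x + g x *\<^sub>R Df x)"
  unfolding C1_fun_def
proof (intro conjI allI)
  fix x
  show "((\<lambda>x. f x * g x) has_derivative (\<lambda>h. (f x *\<^sub>R Dg x + g x *\<^sub>R Df x) \<bullet> h)) (at x)"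
    using assms unfolding C1_fun_def
    by (auto intro!: derivative_eq_intros simp: inner_add_left)
  show "continuous_on UNIV (\<lambda>x. f x *\<^sub>R Dg x + g x *\<^sub>R Df x)"
    using assms C1_fun_continuous[OF assms(1)] C1_fun_continuous[OF assms(2)] unfolding C1_fun_def
    by (intro continuous_intros) auto
qed

lemma C1_fun_compose:
  assumes "C1_fun f Df" "\<And>r. (G has_real_derivative G' r) (at r)" "continuous_on UNIV G'"
  shows "C1_fun (\<lambda>x. G (f x)) (\<lambda>x. G' (f x) *\<^sub>R Df x)"
  unfolding C1_fun_def
proof (intro conjI allI)
  fix x
  have "(f has_derivative (\<lambda>h. Df x \<bullet> h)) (at x)" using assms(1) by (auto simp: C1_fun_def)
  from has_derivative_compose[OF this, of G "\<lambda>h. G' (f x) * h"] assms(2)[of "f x"]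
  show "((\<lambda>x. G (f x)) has_derivative (\<lambda>h. (G' (f x) *\<^sub>R Df x) \<bullet> h)) (at x)"
    by (simp add: has_field_derivative_def)
  have "continuous_on UNIV (\<lambda>x. G' (f x))"
    using continuous_on_compose2[OF assms(3) C1_fun_continuous[OF assms(1)]] by simp
  then show "continuous_on UNIV (\<lambda>x. G' (f x) *\<^sub>R Df x)"
    using assms unfolding C1_fun_def by (intro continuous_intros) auto
qed

text \<open>Squaring removes the kink of the positive part at 0. This is the source of C^1 functions
  whose nonvanishing set is exactly a half-space or a ball.\<close>

lemma has_real_derivative_pos_part_square:
  "((\<lambda>r::real. (max 0 r)\<^sup>2) has_real_derivative 2 * max 0 r) (at r)"
proof -
  consider "r < 0" | "r > 0" | "r = 0" by linarith
  then show ?thesis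
  proof cases
    case 1
    have "((\<lambda>r::real. 0) has_real_derivative 2 * max 0 r) (at r)" using 1 by simp
    then show ?thesis
      by (rule has_field_derivative_transform_within_open[of _ _ _ "{..<0}"]) (use 1 in auto)
  next
    case 2
    have "((\<lambda>r::real. r\<^sup>2) has_real_derivative 2 * max 0 r) (at r)"
      using 2 by (auto intro!: derivative_eq_intros)
    then show ?thesis
      by (rule has_field_derivative_transform_within_open[of _ _ _ "{0<..}"]) (use 2 in auto)
  next
    case 3
    have "((\<lambda>y::real. (max 0 y)\<^sup>2 / y) \<longlongrightarrow> 0) (at 0)"
    proof (rule Lim_null_comparison)
      show "\<forall>\<^sub>F y::real in at 0. norm ((max 0 y)\<^sup>2 / y) \<le> \<bar>y\<bar>"
        by (rule always_eventually) (auto simp: max_def power2_eq_square)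
      show "((\<lambda>y::real. \<bar>y\<bar>) \<longlongrightarrow> 0) (at 0)" by (intro tendsto_eq_intros) auto
    qed
    then show ?thesis using 3 by (simp add: has_field_derivative_iff)
  qed
qed

lemma C1_fun_const: "C1_fun (\<lambda>x. c) (\<lambda>x. 0)"
  by (simp add: C1_fun_def)

lemma C1_fun_scale:
  assumes "C1_fun f Df" shows "C1_fun (\<lambda>x. c * f x) (\<lambda>x. c *\<^sub>R Df x)"
  using C1_fun_mult[OF C1_fun_const[of c] assms] by simp

lemma C1_fun_halfspace:
  "C1_fun (\<lambda>x. (max 0 (a - x \<bullet> i))\<^sup>2) (\<lambda>x. (2 * max 0 (a - x \<bullet> i)) *\<^sub>R (- i))"
proof (rule C1_fun_compose[of "\<lambda>x. a - x \<bullet> i" "\<lambda>x. - i"])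
  show "C1_fun (\<lambda>x. a - x \<bullet> i) (\<lambda>x. - i)"
    unfolding C1_fun_def by (auto intro!: derivative_eq_intros simp: inner_commute)
qed (auto intro: has_real_derivative_pos_part_square intro!: continuous_intros)

text \<open>Here \<open>r\<close> is the squared radius; the inner product replaces the norm so that
  the function is differentiable at the centre too.\<close>

lemma C1_fun_ball:
  "C1_fun (\<lambda>x. (max 0 (r - (x - c) \<bullet> (x - c)))\<^sup>2) (\<lambda>x. (2 * max 0 (r - (x - c) \<bullet> (x - c))) *\<^sub>R ((-2) *\<^sub>R (x - c)))"
proof (rule C1_fun_compose[of "\<lambda>x. r - (x - c) \<bullet> (x - c)" "\<lambda>x. (-2) *\<^sub>R (x - c)"])
  show "C1_fun (\<lambda>x. r - (x - c) \<bullet> (x - c)) (\<lambda>x. (-2) *\<^sub>R (x - c))"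
    unfolding C1_fun_def
    by (auto intro!: derivative_eq_intros continuous_intros simp: inner_commute algebra_simps)
qed (auto intro: has_real_derivative_pos_part_square intro!: continuous_intros)

text \<open>The functions \<open>(k f)\<^sup>2 / (1 + (k f)\<^sup>2)\<close> increase to the indicator of \<open>{f \<noteq> 0}\<close>; sets of this
  form are closed under intersection and generate the Borel sets.\<close>

lemma AE_zero_if_C1_integrals_zero:
  fixes w :: "real^'n \<Rightarrow> 'b::euclidean_space"
  assumes w: "integrable lborel w"
    and z: "\<And>f Df. C1_fun f Df \<Longrightarrow> (LINT x|lborel. ((f x)\<^sup>2 / (1 + (f x)\<^sup>2)) *\<^sub>R w x) = 0"
  shows "AE x in lborel. w x = 0"
proof -
  have wm[measurable]: "w \<in> borel_measurable lborel" using w by auto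
  define E where "E = {{x::real^'n. f x \<noteq> 0} | f Df. C1_fun f Df}"
  have basic_E: "(LINT x:{x. f x \<noteq> 0}|lborel. w x) = 0" if f: "C1_fun f Df" for f Df
  proof -
    have fm[measurable]: "f \<in> borel_measurable borel"
      by (rule borel_measurable_continuous_onI[OF C1_fun_continuous[OF f]])
    define s where "s = (\<lambda>k x. ((real k * f x)\<^sup>2 / (1 + (real k * f x)\<^sup>2)) *\<^sub>R w x)"
    have "(\<lambda>k. LINT x|lborel. s k x) \<longlonglongrightarrow> (LINT x|lborel. indicator {x. f x \<noteq> 0} x *\<^sub>R w x)"
    proof (rule integral_dominated_convergence[where w="\<lambda>x. norm (w x)"])
      show "integrable lborel (\<lambda>x. norm (w x))" using w by simp
      show "AE x in lborel. (\<lambda>k. s k x) \<longlonglongrightarrow> indicator {x. f x \<noteq> 0} x *\<^sub>R w x"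
      proof (rule AE_I2)
        fix x
        show "(\<lambda>k. s k x) \<longlonglongrightarrow> indicator {x. f x \<noteq> 0} x *\<^sub>R w x"
        proof (cases "f x = 0")
          case True then show ?thesis by (simp add: s_def)
        next
          case False
          have "(\<lambda>k. 1 - 1 / (1 + (real k * f x)\<^sup>2)) \<longlonglongrightarrow> 1 - 0"
          proof (intro tendsto_diff tendsto_const)
            have "filterlim (\<lambda>k. (real k * f x)\<^sup>2) at_top sequentially"
            proof -
              have "filterlim (\<lambda>k. (real k * \<bar>f x\<bar>) ^ 2) at_top sequentially"
                using False by (intro filterlim_pow_at_top filterlim_at_top_mult_tendsto_pos[OF tendsto_const]
                    filterlim_real_sequentially | simp add: mult.commute)+
              then show ?thesis by (simp add: power_mult_distrib)
            qed
            then show "(\<lambda>k. 1 / (1 + (real k * f x)\<^sup>2)) \<longlonglongrightarrow> 0"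
              by (intro tendsto_divide_0[OF tendsto_const] filterlim_at_top_imp_at_infinity
                  filterlim_tendsto_add_at_top[OF tendsto_const])
          qed
          moreover have "1 - 1 / (1 + (real k * f x)\<^sup>2) = (real k * f x)\<^sup>2 / (1 + (real k * f x)\<^sup>2)" for k
          proof -
            have "1 + (real k * f x)\<^sup>2 > 0" by (simp add: add_pos_nonneg)
            then show ?thesis by (simp add: field_simps)
          qed
          ultimately have "(\<lambda>k. (real k * f x)\<^sup>2 / (1 + (real k * f x)\<^sup>2)) \<longlonglongrightarrow> 1" by simp
          from tendsto_scaleR[OF this tendsto_const[of "w x"]] False
          show ?thesis by (simp add: s_def)
        qed
      qed
      show "AE x in lborel. norm (s k x) \<le> norm (w x)" for k
      proof (rule AE_I2)
        fix x
        have p: "1 + (real k * f x)\<^sup>2 > 0" by (simp add: add_pos_nonneg)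
        have "\<bar>(real k * f x)\<^sup>2 / (1 + (real k * f x)\<^sup>2)\<bar> \<le> 1"
          using p by (simp add: abs_div divide_le_eq)
        then show "norm (s k x) \<le> norm (w x)"
          unfolding s_def norm_scaleR real_norm_def by (intro mult_left_le_one_le) auto
      qed
    qed (auto simp: s_def)
    moreover have "(LINT x|lborel. s k x) = 0" for k
      unfolding s_def by (rule z[OF C1_fun_scale[OF f]])
    ultimately show ?thesis by (simp add: set_lebesgue_integral_def LIMSEQ_const_iff)
  qed
  \<comment> \<open>The constant 1 has the whole space as its nonvanishing set; the complement case
    of the induction below needs this total integral.\<close>
  have all0: "(LINT x|lborel. w x) = 0"
    using basic_E[OF C1_fun_const[of 1]] by (simp add: set_lebesgue_integral_def)
  have Int: "Int_stable E"
  proof (rule Int_stableI)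
    fix a b assume "a \<in> E" "b \<in> E"
    then obtain f Df g Dg where "a = {x. f x \<noteq> 0}" "C1_fun f Df" "b = {x. g x \<noteq> 0}" "C1_fun g Dg"
      unfolding E_def by blast
    then show "a \<inter> b \<in> E" unfolding E_def using C1_fun_mult[of f Df g Dg]
      by (intro CollectI exI[of _ "\<lambda>x. f x * g x"]) auto
  qed
  have sub: "sets borel \<subseteq> sigma_sets UNIV E"
  proof -
    have "sets borel = sigma_sets UNIV ((\<lambda>(a, i). {x::real^'n. x \<bullet> i < a}) ` (UNIV \<times> Basis))"
      by (subst borel_eq_halfspace_less) auto
    also have "\<dots> \<subseteq> sigma_sets UNIV E"
    proof (rule sigma_sets_mono', safe)
      fix a :: real and i :: "real^'n"
      have "{x. x \<bullet> i < a} = {x. (max 0 (a - x \<bullet> i))\<^sup>2 \<noteq> 0}" by (auto simp: max_def)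
      then show "{x. x \<bullet> i < a} \<in> E" unfolding E_def using C1_fun_halfspace[of a i]
        by (intro CollectI exI conjI)
    qed
    finally show ?thesis .
  qed
  have E_borel: "sigma_sets UNIV E \<subseteq> sets borel"
  proof (rule sets.sigma_sets_subset[of _ borel, simplified])
    show "E \<subseteq> sets borel"
    proof
      fix a assume "a \<in> E"
      then obtain f Df where f: "a = {x. f x \<noteq> 0}" "C1_fun f Df" unfolding E_def by blast
      have [measurable]: "f \<in> borel_measurable borel"
        by (rule borel_measurable_continuous_onI[OF C1_fun_continuous[OF f(2)]])
      show "a \<in> sets borel" unfolding f(1) by measurable
    qed
  qed
  \<comment> \<open>Vanishing of the integral passes to complements and countable disjoint unions,
    so the pi-lambda theorem carries it from \<open>E\<close> to all Borel sets.\<close>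
  have *: "(LINT x:A|lborel. w x) = 0" if "A \<in> sets lborel" for A
  proof -
    have "A \<in> sigma_sets UNIV E" using that sub by auto
    have "E \<subseteq> Pow UNIV" by simp
    from Int this \<open>A \<in> sigma_sets UNIV E\<close> show ?thesis
    proof (induction rule: sigma_sets_induct_disjoint)
      case (basic A) then show ?case using basic_E unfolding E_def by auto
    next
      case empty then show ?case by (simp add: set_lebesgue_integral_def)
    next
      case (compl A)
      then have [measurable]: "A \<in> sets borel" using E_borel by auto
      have "(LINT x:A \<union> (UNIV - A)|lborel. w x) = (LINT x:A|lborel. w x) + (LINT x:UNIV - A|lborel. w x)"
        by (rule set_integral_Un) (auto simp: set_integrable_def intro!: integrable_mult_indicator w)
      then show ?case using compl all0 by (simp add: set_lebesgue_integral_def)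
    next
      case (union A)
      have m: "A i \<in> sets lborel" for i using union E_borel by auto
      have "(LINT x:\<Union>(range A)|lborel. w x) = (\<Sum>i. (LINT x:A i|lborel. w x))"
      proof (rule lebesgue_integral_countable_add)
        show "set_integrable lborel (\<Union> (range A)) w" unfolding set_integrable_def
          using m by (intro integrable_mult_indicator w) auto
      qed (use m union in \<open>auto simp: disjoint_family_on_def\<close>)
      then show ?case using union by simp
    qed
  qed
  show ?thesis
    by (rule sigma_finite_measure.density_zero[OF lborel.sigma_finite_measure_axioms w *])
qed

section \<open>Uniqueness of the weak gradient\<close>

lemma is_test_C1: "is_test \<Omega> \<phi> D\<phi> \<Longrightarrow> C1_fun \<phi> D\<phi>"
  by (auto simp: is_test_def C1_fun_def)

lemma is_test_grad_zero:
  assumes "is_test \<Omega> \<phi> D\<phi>" "x \<notin> closure {x. \<phi> x \<noteq> 0}"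
  shows "D\<phi> x = 0"
proof -
  have d: "(\<phi> has_derivative (\<lambda>h. D\<phi> x \<bullet> h)) (at x)" using assms by (auto simp: is_test_def)
  have "((\<lambda>x. 0) has_derivative (\<lambda>h. D\<phi> x \<bullet> h)) (at x)"
    by (rule has_derivative_transform_within_open[OF d, of "- closure {x. \<phi> x \<noteq> 0}"])
       (use assms(2) closure_subset[of "{x. \<phi> x \<noteq> 0}"] in auto)
  from has_derivative_unique[OF this has_derivative_const]
  have "D\<phi> x \<bullet> D\<phi> x = 0" by meson
  then show ?thesis by simp
qed

lemma compact_support_bounded:
  fixes f :: "real^'n \<Rightarrow> 'b::real_normed_vector"
  assumes "compact K" "\<And>x. x \<notin> K \<Longrightarrow> f x = 0" "continuous_on UNIV f"
  obtains B where "B \<ge> 0" "\<And>x. norm (f x) \<le> B"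
proof -
  have "bounded (f ` K)"
    using assms(1,3) by (intro compact_imp_bounded compact_continuous_image) (auto intro: continuous_on_subset)
  then obtain B where B: "\<And>x. x \<in> K \<Longrightarrow> norm (f x) \<le> B" unfolding bounded_iff by auto
  have "norm (f x) \<le> max 0 B" for x using B[of x] assms(2)[of x] by (cases "x \<in> K") auto
  then show ?thesis using that[of "max 0 B"] by auto
qed

lemma is_test_bounded:
  assumes "is_test \<Omega> \<phi> D\<phi>"
  obtains B where "B \<ge> 0" "\<And>x. \<bar>\<phi> x\<bar> \<le> B" "\<And>x. norm (D\<phi> x) \<le> B"
proof -
  let ?K = "closure {x. \<phi> x \<noteq> 0}"
  have K: "compact ?K" using assms by (auto simp: is_test_def)
  have c: "continuous_on UNIV \<phi>" "continuous_on UNIV D\<phi>"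
    using is_test_C1[OF assms] C1_fun_continuous by (auto simp: C1_fun_def)
  obtain B1 where B1: "B1 \<ge> 0" "\<And>x. norm (\<phi> x) \<le> B1"
    by (rule compact_support_bounded[OF K _ c(1)]) (use closure_subset[of "{x. \<phi> x \<noteq> 0}"] in auto)
  obtain B2 where B2: "B2 \<ge> 0" "\<And>x. norm (D\<phi> x) \<le> B2"
    by (rule compact_support_bounded[OF K is_test_grad_zero[OF assms] c(2)]) auto
  show ?thesis using B1 B2 by (intro that[of "max B1 B2"]) (auto simp: le_max_iff_disj)
qed

lemma is_test_borel:
  assumes "is_test \<Omega> \<phi> D\<phi>"
  shows "\<phi> \<in> borel_measurable borel" "D\<phi> \<in> borel_measurable borel"
  using is_test_C1[OF assms] C1_fun_continuous
  by (auto simp: C1_fun_def intro!: borel_measurable_continuous_onI)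

text \<open>The support can only shrink under multiplication. This is what admits the detecting
  weights into the weak formulation.\<close>

lemma is_test_mult:
  assumes "is_test \<Omega> \<phi> D\<phi>" "C1_fun f Df"
  shows "is_test \<Omega> (\<lambda>x. \<phi> x * f x) (\<lambda>x. \<phi> x *\<^sub>R Df x + f x *\<^sub>R D\<phi> x)"
proof -
  have "closure {x. \<phi> x * f x \<noteq> 0} \<subseteq> closure {x. \<phi> x \<noteq> 0}" by (intro closure_mono) auto
  moreover have "compact (closure {x. \<phi> x * f x \<noteq> 0})"
    using compact_Int_closed[of "closure {x. \<phi> x \<noteq> 0}" "closure {x. \<phi> x * f x \<noteq> 0}"] calculation assms(1)
    by (simp add: is_test_def Int_absorb1)
  ultimately show ?thesis
    using C1_fun_mult[OF is_test_C1[OF assms(1)] assms(2)] assms(1)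
    unfolding is_test_def C1_fun_def by blast
qed

lemma has_real_derivative_saturation:
  "((\<lambda>r::real. r\<^sup>2 / (1 + r\<^sup>2)) has_real_derivative 2 * r / (1 + r\<^sup>2)\<^sup>2) (at r)"
proof -
  have "1 + r\<^sup>2 > 0" by (simp add: add_pos_nonneg)
  then have "1 + r\<^sup>2 \<noteq> 0" by simp
  then show ?thesis
    by (auto intro!: derivative_eq_intros simp: divide_simps power2_eq_square algebra_simps)
qed

text \<open>The detecting weights are themselves C^1, hence legitimate factors in
  \<open>is_test_mult\<close>.\<close>

lemma C1_fun_saturation:
  assumes "C1_fun f Df"
  shows "C1_fun (\<lambda>x. (f x)\<^sup>2 / (1 + (f x)\<^sup>2)) (\<lambda>x. (2 * f x / (1 + (f x)\<^sup>2)\<^sup>2) *\<^sub>R Df x)"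
proof (rule C1_fun_compose[OF assms has_real_derivative_saturation])
  have "1 + r\<^sup>2 \<noteq> 0" for r :: real using zero_le_power2[of r] by linarith
  then show "continuous_on UNIV (\<lambda>r::real. 2 * r / (1 + r\<^sup>2)\<^sup>2)"
    by (auto intro!: continuous_intros)
qed

text \<open>A test function is bounded, and on a set of finite measure L^2 embeds into L^1 through
  |g| <= 1 + |g|^2.\<close>

lemma set_integrable_test_scaleR:
  fixes \<Omega> :: "(real^'n) set"
  assumes "open \<Omega>" "bounded \<Omega>" "is_test \<Omega> \<phi> D\<phi>" "L2v \<Omega> g"
  shows "set_integrable lborel \<Omega> (\<lambda>x. \<phi> x *\<^sub>R g x)"
proof -
  obtain B where B: "B \<ge> 0" "\<And>x. \<bar>\<phi> x\<bar> \<le> B" using is_test_bounded[OF assms(3)] by metis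
  have [measurable]: "\<phi> \<in> borel_measurable borel" "g \<in> borel_measurable borel" "\<Omega> \<in> sets borel"
    using is_test_borel[OF assms(3)] assms by (auto simp: L2v_def)
  have fin: "emeasure lborel \<Omega> < \<infinity>" by (rule emeasure_bounded_finite[OF assms(2)])
  have "integrable lborel (\<lambda>x. B * (indicator \<Omega> x *\<^sub>R 1 + indicator \<Omega> x *\<^sub>R (norm (g x))\<^sup>2))"
    using assms(4) fin unfolding L2v_def set_integrable_def by (intro integrable_mult_right Bochner_Integration.integrable_add) auto
  then show ?thesis unfolding set_integrable_def
  proof (rule Bochner_Integration.integrable_bound)
    show "AE x in lborel. norm (indicator \<Omega> x *\<^sub>R \<phi> x *\<^sub>R g x)
        \<le> norm (B * (indicator \<Omega> x *\<^sub>R 1 + indicator \<Omega> x *\<^sub>R (norm (g x))\<^sup>2))"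
    proof (rule AE_I2)
      fix x
      have "norm (g x) \<le> 1 + (norm (g x))\<^sup>2"
        using zero_le_power2[of "norm (g x) - 1"] norm_ge_zero[of "g x"]
        unfolding power2_diff by (simp add: power2_eq_square) (smt (verit) zero_le_square)
      then have "\<bar>\<phi> x\<bar> * norm (g x) \<le> B * (1 + (norm (g x))\<^sup>2)"
        using B by (intro mult_mono) auto
      then show "norm (indicator \<Omega> x *\<^sub>R \<phi> x *\<^sub>R g x)
        \<le> norm (B * (indicator \<Omega> x *\<^sub>R 1 + indicator \<Omega> x *\<^sub>R (norm (g x))\<^sup>2))"
        using B by (auto simp: indicator_def abs_mult)
    qed
  qed simp
qed

text \<open>The function is the squared positive part of r^2 - |x - c|^2. Its support is the closed
  ball, which is why that ball has to lie inside \<Omega>.\<close>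

lemma is_test_ball:
  fixes c :: "real^'n"
  assumes "cball c r \<subseteq> \<Omega>" "r > 0"
  obtains \<phi> D\<phi> where "is_test \<Omega> \<phi> D\<phi>" "\<And>x. x \<in> ball c r \<Longrightarrow> \<phi> x \<noteq> 0"
proof -
  let ?\<phi> = "\<lambda>x. (max 0 (r\<^sup>2 - (x - c) \<bullet> (x - c)))\<^sup>2"
  have eq: "{x. ?\<phi> x \<noteq> 0} = ball c r"
  proof -
    have "?\<phi> x \<noteq> 0 \<longleftrightarrow> norm (x - c) < r" for x
    proof -
      have "?\<phi> x \<noteq> 0 \<longleftrightarrow> (norm (x - c))\<^sup>2 < r\<^sup>2"
        by (auto simp: max_def dot_square_norm)
      also have "\<dots> \<longleftrightarrow> norm (x - c) < r" using assms(2)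
        by (metis norm_ge_zero power_less_imp_less_base power_strict_mono less_imp_le zero_less_numeral)
      finally show ?thesis .
    qed
    then show ?thesis by (simp only: set_eq_iff mem_Collect_eq mem_ball dist_norm norm_minus_commute[of c] simp_thms)
  qed
  have cl: "closure (ball c r) = cball c r" using assms(2) by simp
  have "is_test \<Omega> ?\<phi> (\<lambda>x. (2 * max 0 (r\<^sup>2 - (x - c) \<bullet> (x - c))) *\<^sub>R ((-2) *\<^sub>R (x - c)))"
    unfolding is_test_def eq cl
    by (intro conjI C1_fun_ball[of "r\<^sup>2" c, unfolded C1_fun_def, THEN conjunct1]
        C1_fun_ball[of "r\<^sup>2" c, unfolded C1_fun_def, THEN conjunct2] compact_cball assms(1))
  then show ?thesis using that eq by blast
qed

text \<open>For a test function \<phi> and a detecting weight q, the product \<phi> q is again a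
  test function, so \<phi> (g - g') integrates to 0 against every such q and vanishes almost
  everywhere. Hence g = g' almost everywhere on {\<phi> \<noteq> 0}, and by Lindelof countably many
  balls, each carrying such a \<phi>, exhaust \<Omega>.\<close>

lemma weak_grad_AE_unique:
  fixes \<Omega> :: "(real^'n) set"
  assumes \<Omega>: "open \<Omega>" "bounded \<Omega>"
    and g: "L2v \<Omega> g" "weak_grad \<Omega> u g" and g': "L2v \<Omega> g'" "weak_grad \<Omega> u g'"
  shows "AE x in lborel. x \<in> \<Omega> \<longrightarrow> g x = g' x"
proof -
  have on_support: "AE x in lborel. x \<in> \<Omega> \<longrightarrow> \<phi> x \<noteq> 0 \<longrightarrow> g x = g' x" if t: "is_test \<Omega> \<phi> D\<phi>" for \<phi> D\<phi>
  proof -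
    define w where "w = (\<lambda>x. indicator \<Omega> x *\<^sub>R \<phi> x *\<^sub>R (g x - g' x))"
    have wi: "integrable lborel w"
    proof -
      have "integrable lborel (\<lambda>x. indicator \<Omega> x *\<^sub>R \<phi> x *\<^sub>R g x - indicator \<Omega> x *\<^sub>R \<phi> x *\<^sub>R g' x)"
        using set_integrable_test_scaleR[OF \<Omega> t g(1)] set_integrable_test_scaleR[OF \<Omega> t g'(1)]
        unfolding set_integrable_def by (rule Bochner_Integration.integrable_diff)
      then show ?thesis unfolding w_def by (simp add: scaleR_diff_right)
    qed
    have "AE x in lborel. w x = 0"
    proof (rule AE_zero_if_C1_integrals_zero[OF wi])
      fix f :: "real^'n \<Rightarrow> real" and Df assume f: "C1_fun f Df"
      define q where "q = (\<lambda>x. (f x)\<^sup>2 / (1 + (f x)\<^sup>2))"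
      obtain Dt where t2: "is_test \<Omega> (\<lambda>x. \<phi> x * q x) Dt"
        using is_test_mult[OF t C1_fun_saturation[OF f]] unfolding q_def by blast
      note i = set_integrable_test_scaleR[OF \<Omega> t2 g(1)] set_integrable_test_scaleR[OF \<Omega> t2 g'(1)]
      have "(LINT x:\<Omega>|lborel. (\<phi> x * q x) *\<^sub>R g x) = (LINT x:\<Omega>|lborel. (\<phi> x * q x) *\<^sub>R g' x)"
        using g(2)[unfolded weak_grad_def, rule_format, OF t2] g'(2)[unfolded weak_grad_def, rule_format, OF t2]
        by simp
      then have "(LINT x:\<Omega>|lborel. (\<phi> x * q x) *\<^sub>R g x - (\<phi> x * q x) *\<^sub>R g' x) = 0"
        using set_integral_diff(2)[OF i] by simp
      moreover have "(LINT x:\<Omega>|lborel. (\<phi> x * q x) *\<^sub>R g x - (\<phi> x * q x) *\<^sub>R g' x) = (LINT x|lborel. q x *\<^sub>R w x)"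
        unfolding set_lebesgue_integral_def w_def
        by (intro Bochner_Integration.integral_cong) (auto simp: scaleR_diff_right mult_ac)
      ultimately show "(LINT x|lborel. ((f x)\<^sup>2 / (1 + (f x)\<^sup>2)) *\<^sub>R w x) = 0" by (simp add: q_def)
    qed
    then show ?thesis by eventually_elim (auto simp: w_def)
  qed
  define F where "F = {ball c r | c r. r > 0 \<and> cball c r \<subseteq> \<Omega>}"
  obtain F' where F': "F' \<subseteq> F" "countable F'" "\<Union>F' = \<Union>F"
    by (rule Lindelof[of F]) (auto simp: F_def)
  have UF: "\<Union>F = \<Omega>"
  proof
    show "\<Union>F \<subseteq> \<Omega>" unfolding F_def using ball_subset_cball by blast
    show "\<Omega> \<subseteq> \<Union>F"
    proof
      fix x assume "x \<in> \<Omega>"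
      then obtain e where e: "e > 0" "cball x e \<subseteq> \<Omega>" using \<Omega>(1) open_contains_cball by blast
      then have "ball x e \<in> F" "x \<in> ball x e" unfolding F_def by auto
      then show "x \<in> \<Union>F" by blast
    qed
  qed
  have "AE x in lborel. \<forall>b\<in>F'. x \<in> b \<longrightarrow> g x = g' x"
  proof (subst AE_ball_countable[OF F'(2)], intro ballI)
    fix b assume "b \<in> F'"
    then obtain c r where b: "b = ball c r" "r > 0" "cball c r \<subseteq> \<Omega>" using F'(1) unfolding F_def by blast
    obtain \<phi> D\<phi> where t: "is_test \<Omega> \<phi> D\<phi>" "\<And>x. x \<in> ball c r \<Longrightarrow> \<phi> x \<noteq> 0"
      using is_test_ball[OF b(3,2)] by blast
    have sub: "b \<subseteq> \<Omega>" using b ball_subset_cball by blast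
    show "AE x in lborel. x \<in> b \<longrightarrow> g x = g' x"
      using on_support[OF t(1)] by eventually_elim (use t(2) sub b(1) in auto)
  qed
  then show ?thesis by eventually_elim (use F'(3) UF in auto)
qed

section \<open>The subcritical Sobolev inequality\<close>

text \<open>The three-factor Young inequality behind the Sobolev inequality: for \<open>d = |\<nabla>f(x + t\<omega>)|\<close>, the
  first term stays integrable after integration over \<open>x\<close>, the other two already after integration
  over \<open>\<omega>\<close> and \<open>t\<close>. The relation on \<open>\<beta>\<close> makes both sides scale alike in \<open>t\<close>.\<close>

lemma young_kernel_bound:
  fixes p \<beta> \<gamma> \<delta> t d \<sigma> :: real
  assumes p: "p > 2" and t: "t > 0" and d: "d \<ge> 0" and \<sigma>: "\<sigma> > 0"
    and \<beta>: "2 * \<beta> = \<delta> * p - \<gamma> * (p - 2)"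
  shows "d \<le> \<sigma> powr (1 - p) * (t powr \<beta> * d\<^sup>2) + \<sigma> * (t powr \<gamma> * d\<^sup>2 + t powr (- \<delta>))"
proof (cases "d = 0")
  case True then show ?thesis using \<sigma> by simp
next
  case False
  then have d0: "d > 0" using d by simp
  define Z where "Z = t powr \<gamma> * d\<^sup>2 + t powr (- \<delta>)"
  have Z1: "t powr \<gamma> * d\<^sup>2 \<le> Z" "t powr (- \<delta>) \<le> Z" using t by (auto simp: Z_def)
  have Z0: "Z > 0" using t d0 by (auto simp: Z_def intro!: add_pos_pos)
  show ?thesis
  \<comment> \<open>Below the threshold \<sigma> Z the second summand alone dominates d; above it
    \<sigma> <= d / Z, and the first summand does.\<close>
  proof (cases "d \<le> \<sigma> * Z")
    case True
    moreover have "\<sigma> powr (1 - p) * (t powr \<beta> * d\<^sup>2) \<ge> 0" by simp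
    ultimately show ?thesis unfolding Z_def by linarith
  next
    case lt: False
    then have s: "\<sigma> \<le> d / Z" using Z0 by (simp add: field_simps)
    \<comment> \<open>The exponents (p-2)/2 and p/2 add up to p - 1, and by the relation on \<beta>
      they combine the powers of t into t^(-\<beta>).\<close>
    have "(t powr \<gamma> * d\<^sup>2) powr ((p - 2) / 2) * (t powr (- \<delta>)) powr (p / 2)
        \<le> Z powr ((p - 2) / 2) * Z powr (p / 2)"
      using Z1 p by (intro mult_mono powr_mono2) auto
    also have "\<dots> = Z powr (p - 1)" by (simp add: powr_add[symmetric] diff_divide_distrib)
    also have "(t powr \<gamma> * d\<^sup>2) powr ((p - 2) / 2) * (t powr (- \<delta>)) powr (p / 2) = t powr (- \<beta>) * d powr (p - 2)"
    proof -
      have e1: "(d\<^sup>2) powr ((p - 2) / 2) = d powr (p - 2)"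
        using d0 by (simp add: powr_numeral[symmetric] powr_powr diff_divide_distrib del: powr_numeral)
      have e2: "t powr (\<gamma> * ((p - 2) / 2)) * t powr (- \<delta> * (p / 2)) = t powr (- \<beta>)"
      proof -
        have "\<gamma> * ((p - 2) / 2) + - \<delta> * (p / 2) = - \<beta>" using \<beta> by (simp add: field_simps)
        then show ?thesis by (metis powr_add)
      qed
      have "(t powr \<gamma> * d\<^sup>2) powr ((p - 2) / 2) * (t powr (- \<delta>)) powr (p / 2)
          = t powr (\<gamma> * ((p - 2) / 2)) * (d\<^sup>2) powr ((p - 2) / 2) * t powr (- \<delta> * (p / 2))"
        using t by (simp only: powr_mult powr_powr)
      also have "\<dots> = (t powr (\<gamma> * ((p - 2) / 2)) * t powr (- \<delta> * (p / 2))) * (d\<^sup>2) powr ((p - 2) / 2)"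
        by (simp only: mult_ac)
      finally show ?thesis by (simp only: e1 e2)
    qed
    finally have Zp: "t powr (- \<beta>) * d powr (p - 2) \<le> Z powr (p - 1)" .
    \<comment> \<open>All powers cancel down to d. In this form the bracket can be replaced by
      Z^(p-1), which merges with d^(1-p) into (d / Z)^(1-p), a decreasing function of d / Z.\<close>
    have "d = (t powr (- \<beta>) * d powr (p - 2)) * d powr (1 - p) * (t powr \<beta> * d\<^sup>2)"
    proof -
      have "d powr (p - 2) * d powr (1 - p) * d\<^sup>2 = d powr (p - 2 + (1 - p) + 2)"
        using d0 by (simp only: powr_add) simp
      also have "\<dots> = d" using d0 by simp
      finally have 1: "d powr (p - 2) * d powr (1 - p) * d\<^sup>2 = d" .
      have 2: "t powr (- \<beta>) * t powr \<beta> = 1" using t by (simp add: powr_add[symmetric])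
      have "(t powr (- \<beta>) * d powr (p - 2)) * d powr (1 - p) * (t powr \<beta> * d\<^sup>2)
        = (t powr (- \<beta>) * t powr \<beta>) * (d powr (p - 2) * d powr (1 - p) * d\<^sup>2)" by (simp add: mult_ac)
      then show ?thesis using 1 2 by simp
    qed
    also have "\<dots> \<le> Z powr (p - 1) * d powr (1 - p) * (t powr \<beta> * d\<^sup>2)"
      using Zp by (intro mult_right_mono) auto
    also have "Z powr (p - 1) * d powr (1 - p) = (d / Z) powr (1 - p)"
      using Z0 d0 by (simp add: powr_divide powr_diff field_simps)
    also have "(d / Z) powr (1 - p) * (t powr \<beta> * d\<^sup>2) \<le> \<sigma> powr (1 - p) * (t powr \<beta> * d\<^sup>2)"
      using s \<sigma> p by (intro mult_right_mono powr_mono2') auto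
    finally have "d \<le> \<sigma> powr (1 - p) * (t powr \<beta> * d\<^sup>2)" .
    moreover have "\<sigma> * Z \<ge> 0" using \<sigma> Z0 by simp
    ultimately show ?thesis unfolding Z_def by linarith
  qed
qed

text \<open>Optimisation over \<sigma>: at \<sigma> = y / (2 K) the second term equals y / 2 and is
  absorbed on the left; multiplying the rest by y^(p-1) eliminates \<sigma>.\<close>

lemma powr_le_of_young_family:
  fixes y X K p :: real
  assumes p: "p > 1" and "y \<ge> 0" "X \<ge> 0" and K: "K > 0"
    and H: "\<And>\<sigma>. \<sigma> > 0 \<Longrightarrow> y \<le> \<sigma> powr (1 - p) * X + \<sigma> * K"
  shows "y powr p \<le> 2 * (2 * K) powr (p - 1) * X"
proof (cases "y = 0")
  case True then show ?thesis using assms by simp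
next
  case False
  then have y: "y > 0" using assms by simp
  define \<sigma> where "\<sigma> = y / (2 * K)"
  have "\<sigma> > 0" using y K by (simp add: \<sigma>_def)
  from H[OF this] have "y / 2 \<le> \<sigma> powr (1 - p) * X" using K by (simp add: \<sigma>_def field_simps)
  then have "y powr (p - 1) * (y / 2) \<le> y powr (p - 1) * (\<sigma> powr (1 - p) * X)" by (intro mult_left_mono) auto
  moreover have "y powr (p - 1) * \<sigma> powr (1 - p) = (2 * K) powr (p - 1)"
    using y K by (simp add: \<sigma>_def powr_divide powr_diff powr_mult field_simps)
  moreover have "y powr (p - 1) * y = y powr p" using y by (simp add: powr_diff)
  ultimately have "y powr p / 2 \<le> (2 * K) powr (p - 1) * X" by (simp add: mult.assoc[symmetric])
  then show ?thesis by simp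
qed

lemma nn_integral_lborel_affine:
  fixes f :: "'a::euclidean_space \<Rightarrow> ennreal"
  assumes [measurable]: "f \<in> borel_measurable borel" and c: "c \<noteq> 0"
  shows "(\<integral>\<^sup>+x. f (t + c *\<^sub>R x) \<partial>lborel) = ennreal (1 / \<bar>c\<bar> ^ DIM('a)) * (\<integral>\<^sup>+x. f x \<partial>lborel)"
proof -
  have "(\<integral>\<^sup>+x. f x \<partial>lborel) = ennreal (\<bar>c\<bar> ^ DIM('a)) * (\<integral>\<^sup>+x. f (t + c *\<^sub>R x) \<partial>lborel)"
    by (subst lborel_affine[OF c, of t])
       (simp add: nn_integral_density nn_integral_distr nn_integral_cmult ennreal_power)
  then have "ennreal (1 / \<bar>c\<bar> ^ DIM('a)) * (\<integral>\<^sup>+x. f x \<partial>lborel)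
     = (ennreal (1 / \<bar>c\<bar> ^ DIM('a)) * ennreal (\<bar>c\<bar> ^ DIM('a))) * (\<integral>\<^sup>+x. f (t + c *\<^sub>R x) \<partial>lborel)"
    by (simp only: mult.assoc)
  also have "ennreal (1 / \<bar>c\<bar> ^ DIM('a)) * ennreal (\<bar>c\<bar> ^ DIM('a)) = 1"
    using c by (simp add: ennreal_mult[symmetric])
  finally show ?thesis by simp
qed

lemma nn_integral_powr_Ioc:
  fixes a M :: real
  assumes "a > -1" "M \<ge> 0"
  shows "(\<integral>\<^sup>+t. ennreal (t powr a) * indicator {0<..M} t \<partial>lborel) = ennreal (M powr (a + 1) / (a + 1))"
proof -
  have "(\<integral>\<^sup>+t. ennreal (t powr a) * indicator {0<..M} t \<partial>lborel)
      = (\<integral>\<^sup>+t. ennreal (indicator {0..M} t * t powr a) \<partial>lborel)"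
    \<comment> \<open>The intervals differ only at t = 0, where the right integrand also vanishes
      because \<open>0 powr a = 0\<close>.\<close>
    by (intro nn_integral_cong) (auto simp: indicator_def)
  also have "\<dots> = ennreal (M powr (a + 1) / (a + 1))"
    by (rule nn_integral_has_integral_lebesgue[OF _ has_integral_powr_from_0[OF assms]]) simp
  finally show ?thesis .
qed

text \<open>The fundamental theorem of calculus on a segment that ends at a zero of f. The endpoint
  0 is discarded as a null set, since the weights put on this integral are powers of a positive
  t.\<close>

lemma C1_fun_ray_bound:
  fixes x \<omega> :: "real^'n"
  assumes f: "C1_fun f Df" and M: "M \<ge> 0" and z: "f (x + M *\<^sub>R \<omega>) = 0"
  shows "ennreal \<bar>f x\<bar> \<le> (\<integral>\<^sup>+t. ennreal (norm \<omega> * norm (Df (x + t *\<^sub>R \<omega>))) * indicator {0<..M} t \<partial>lborel)"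
proof -
  let ?g = "\<lambda>t. Df (x + t *\<^sub>R \<omega>) \<bullet> \<omega>"
  have d: "((\<lambda>t. f (x + t *\<^sub>R \<omega>)) has_vector_derivative ?g t) (at t within {0..M})" for t
  proof -
    have "((\<lambda>t. x + t *\<^sub>R \<omega>) has_derivative (\<lambda>h. h *\<^sub>R \<omega>)) (at t within {0..M})"
      by (auto intro!: derivative_eq_intros)
    moreover have "(f has_derivative (\<lambda>h. Df (x + t *\<^sub>R \<omega>) \<bullet> h)) (at (x + t *\<^sub>R \<omega>))"
      using f by (auto simp: C1_fun_def)
    ultimately have "((\<lambda>t. f (x + t *\<^sub>R \<omega>)) has_derivative (\<lambda>h. Df (x + t *\<^sub>R \<omega>) \<bullet> (h *\<^sub>R \<omega>))) (at t within {0..M})"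
      by (rule has_derivative_compose)
    then show ?thesis by (simp add: has_vector_derivative_def)
  qed
  have c: "continuous_on UNIV ?g"
    using f unfolding C1_fun_def
    by (auto intro!: continuous_intros continuous_on_compose2[of UNIV Df UNIV "\<lambda>t. x + t *\<^sub>R \<omega>"])
  have c': "continuous_on {0..M} ?g" by (rule continuous_on_subset[OF c]) simp
  have "integral\<^sup>L lborel (\<lambda>t. indicator {0..M} t *\<^sub>R ?g t) = f (x + M *\<^sub>R \<omega>) - f (x + 0 *\<^sub>R \<omega>)"
    by (rule integral_FTC_atLeastAtMost[OF M d c'])
  then have "ennreal \<bar>f x\<bar> = ennreal (norm (integral\<^sup>L lborel (\<lambda>t. indicator {0..M} t *\<^sub>R ?g t)))" using z by simp
  also have "\<dots> \<le> (\<integral>\<^sup>+t. norm (indicator {0..M} t *\<^sub>R ?g t) \<partial>lborel)"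
    using borel_integrable_atLeastAtMost'[OF c'] unfolding set_integrable_def
    by (rule integral_norm_bound_ennreal)
  also have "\<dots> \<le> (\<integral>\<^sup>+t. ennreal (norm \<omega> * norm (Df (x + t *\<^sub>R \<omega>))) * indicator {0<..M} t \<partial>lborel)"
  proof (rule nn_integral_mono_AE)
    show "AE t in lborel. ennreal (norm (indicator {0..M} t *\<^sub>R ?g t))
      \<le> ennreal (norm \<omega> * norm (Df (x + t *\<^sub>R \<omega>))) * indicator {0<..M} t"
      using AE_lborel_singleton[of 0]
    proof eventually_elim
      fix t :: real assume "t \<noteq> 0"
      then show "ennreal (norm (indicator {0..M} t *\<^sub>R ?g t))
        \<le> ennreal (norm \<omega> * norm (Df (x + t *\<^sub>R \<omega>))) * indicator {0<..M} t"
        using Cauchy_Schwarz_ineq2[of "Df (x + t *\<^sub>R \<omega>)" \<omega>]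
        by (auto simp: indicator_def mult.commute intro!: ennreal_leI)
    qed
  qed
  finally show ?thesis .
qed

text \<open>A positive upper bound N in place of the gradient integral itself makes division by sqrt
  N legitimate even for a vanishing gradient, and it gives approximating functions one common bound.
  K depends on p, R and the dimension only.\<close>

lemma sobolev_C1:
  fixes p R :: real
  assumes p: "p > 2" and sub: "p * (real CARD('n) - 2) < 2 * real CARD('n)" and R: "R > 0"
  shows "\<exists>K>0. \<forall>(f :: real^'n \<Rightarrow> real) Df N. C1_fun f Df \<longrightarrow> (\<forall>x. norm x \<ge> R \<longrightarrow> f x = 0) \<longrightarrow> N > 0 \<longrightarrow>
     (\<integral>\<^sup>+x. ennreal ((norm (Df x))\<^sup>2) \<partial>lborel) \<le> ennreal N \<longrightarrow>
     (\<integral>\<^sup>+x. ennreal (\<bar>f x\<bar> powr p) \<partial>lborel) \<le> ennreal (K * N powr (p / 2))"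
proof -
  define n where "n = real CARD('n)"
  have n1: "n \<ge> 1" unfolding n_def by (simp add: Suc_leI)
  \<comment> \<open>Subcriticality of \<open>p\<close> is exactly what allows \<open>\<beta> > -1\<close>, \<open>\<delta> < 1\<close> and \<open>\<gamma> > n - 1\<close> simultaneously.\<close>
  define \<epsilon> where "\<epsilon> = (2 * n - p * (n - 2)) / (4 * p)"
  have \<epsilon>: "\<epsilon> > 0" using sub p unfolding \<epsilon>_def n_def by simp
  define \<delta> where "\<delta> = 1 - \<epsilon>"
  define \<gamma> where "\<gamma> = n - 1 + \<epsilon>"
  define \<beta> where "\<beta> = (\<delta> * p - \<gamma> * (p - 2)) / 2"
  have \<beta>2: "2 * \<beta> = \<delta> * p - \<gamma> * (p - 2)" by (simp add: \<beta>_def)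
  \<comment> \<open>By the choice of \<epsilon> the subcritical gap is 4 p \<epsilon>, while moving
    \<delta> and \<gamma> off their thresholds costs only \<epsilon> (2 p - 2); the remainder is 2
    \<beta> + 2 = \<epsilon> (2 p + 2).\<close>
  have \<beta>1: "\<beta> > -1"
  proof -
    have "4 * p * \<epsilon> = 2 * n - p * (n - 2)" using p by (simp add: \<epsilon>_def)
    moreover have "\<delta> * p - \<gamma> * (p - 2) + 2 = 2 * n - p * (n - 2) - \<epsilon> * (2 * p - 2)"
      by (simp add: \<delta>_def \<gamma>_def algebra_simps)
    ultimately have "\<delta> * p - \<gamma> * (p - 2) + 2 = \<epsilon> * (2 * p + 2)" by (simp add: algebra_simps)
    moreover have "\<epsilon> * (2 * p + 2) > 0" using \<epsilon> p by simp
    ultimately show ?thesis unfolding \<beta>_def by simp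
  qed
  have \<delta>1: "- \<delta> > -1" and \<gamma>1: "\<gamma> - n > -1" using \<epsilon> by (auto simp: \<delta>_def \<gamma>_def)
  define M where "M = 2 * R"
  have M: "M > 0" using R by (simp add: M_def)
  define e :: "real^'n" where "e = (SOME i. i \<in> Basis)"
  have e: "norm e = 1" unfolding e_def using nonempty_Basis by (metis norm_Basis some_in_eq)
  \<comment> \<open>Directions of length between 1 and 3: every ray from the support has left it at time \<open>M\<close>.\<close>
  define B where "B = ball (2 *\<^sub>R e) 1"
  have Bn: "1 \<le> norm \<omega> \<and> norm \<omega> \<le> 3" if "\<omega> \<in> B" for \<omega>
  proof -
    have "norm (2 *\<^sub>R e - \<omega>) < 1" using that by (simp add: B_def dist_norm)
    moreover have "norm (2 *\<^sub>R e) = 2" using e by simp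
    ultimately show ?thesis
      using norm_triangle_ineq2[of "2 *\<^sub>R e" \<omega>] norm_triangle_ineq3[of "2 *\<^sub>R e" \<omega>] by linarith
  qed
  have Bm[measurable]: "B \<in> sets borel" by (simp add: B_def)
  define b where "b = measure lborel B"
  have b: "b > 0" unfolding b_def B_def using content_ball_pos[of 1 "2 *\<^sub>R e"] by simp
  have eb: "emeasure lborel B = ennreal b"
    unfolding b_def by (rule emeasure_eq_ennreal_measure)
      (use emeasure_bounded_finite[of B] in \<open>auto simp: B_def\<close>)
  define P where "P = (\<lambda>a::real. M powr (a + 1) / (a + 1))"
  have P0: "P a > 0" if "a > -1" for a using that M by (simp add: P_def)
  define T where "T = (\<lambda>a t. ennreal (t powr a) * indicator {0<..M} t)"
  have Tm[measurable]: "T a \<in> borel_measurable borel" for a unfolding T_def by measurable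
  have TI: "(\<integral>\<^sup>+t. T a t \<partial>lborel) = ennreal (P a)" if "a > -1" for a
    unfolding T_def P_def using nn_integral_powr_Ioc[OF that, of M] M by simp
  \<comment> \<open>\<open>K0\<close> bounds, uniformly in x, the \<gamma> and \<delta> terms after
    integration over directions and ray parameter.\<close>
  define K0 where "K0 = P (\<gamma> - n) + b * P (- \<delta>)"
  have K0: "K0 > 0" using P0 \<delta>1 \<gamma>1 b by (simp add: K0_def add_pos_pos)
  \<comment> \<open>The three factors: undoing the normalisation of |f|, the constant of
    \<open>powr_le_of_young_family\<close>, and the bound on the integral of
    \<open>X\<close>.\<close>
  define A where "A = (3 / b) powr p * (2 * (2 * K0) powr (p - 1)) * (b * P \<beta>)"
  have A: "A > 0" using b K0 P0[OF \<beta>1] by (simp add: A_def)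
  show ?thesis
  proof (intro exI[of _ A] conjI A allI impI)
    fix f :: "real^'n \<Rightarrow> real" and Df and N :: real
    assume f: "C1_fun f Df" and supp: "\<forall>x. norm x \<ge> R \<longrightarrow> f x = 0" and N: "N > 0"
      and IN: "(\<integral>\<^sup>+x. ennreal ((norm (Df x))\<^sup>2) \<partial>lborel) \<le> ennreal N"
    have [measurable]: "f \<in> borel_measurable borel" "Df \<in> borel_measurable borel"
      using f C1_fun_continuous[OF f] by (auto simp: C1_fun_def intro: borel_measurable_continuous_onI)
    \<comment> \<open>Dividing by sqrt N makes the integral of d^2 at most 1, so that N reappears
      only through the final rescaling.\<close>
    define d where "d = (\<lambda>y. norm (Df y) / sqrt N)"
    have d0: "d y \<ge> 0" for y using N by (simp add: d_def)
    have [measurable]: "d \<in> borel_measurable borel" unfolding d_def by measurable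
    define g where "g = (\<lambda>y. ennreal ((d y)\<^sup>2))"
    have gm[measurable]: "g \<in> borel_measurable borel" unfolding g_def by measurable
    have g1: "(\<integral>\<^sup>+y. g y \<partial>lborel) \<le> 1"
    proof -
      have "(\<integral>\<^sup>+y. g y \<partial>lborel) = (\<integral>\<^sup>+y. ennreal (1 / N) * ennreal ((norm (Df y))\<^sup>2) \<partial>lborel)"
        unfolding g_def d_def using N
        by (intro nn_integral_cong) (simp add: power_divide ennreal_mult[symmetric])
      also have "\<dots> = ennreal (1 / N) * (\<integral>\<^sup>+y. ennreal ((norm (Df y))\<^sup>2) \<partial>lborel)"
        by (rule nn_integral_cmult) measurable
      also have "\<dots> \<le> ennreal (1 / N) * ennreal N" using IN by (intro mult_left_mono) auto
      also have "\<dots> = 1" using N by (simp add: ennreal_mult[symmetric])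
      finally show ?thesis .
    qed
    \<comment> \<open>\<open>X\<close> collects the \<beta> term, the only one whose control has to
      wait for the integration over x.\<close>
    define X where "X = (\<lambda>x. \<integral>\<^sup>+\<omega>. indicator B \<omega> * (\<integral>\<^sup>+t. T \<beta> t * g (x + t *\<^sub>R \<omega>) \<partial>lborel) \<partial>lborel)"
    \<comment> \<open>The 3 bounds the length of a direction, and b is the volume of
      \<open>B\<close> that appears when a constant is integrated over all directions.\<close>
    define y where "y = (\<lambda>x. \<bar>f x\<bar> * b / (3 * sqrt N))"
    have y0: "y x \<ge> 0" for x using N b by (simp add: y_def)
    have key: "ennreal (y x) \<le> ennreal (\<sigma> powr (1 - p)) * X x + ennreal (\<sigma> * K0)"
      if \<sigma>: "\<sigma> > 0" for x \<sigma>
    proof -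
      define W where "W = (\<lambda>\<omega>. \<integral>\<^sup>+t. ennreal (\<sigma> powr (1 - p)) * (T \<beta> t * g (x + t *\<^sub>R \<omega>))
            + ennreal \<sigma> * (T \<gamma> t * g (x + t *\<^sub>R \<omega>) + T (- \<delta>) t) \<partial>lborel)"
      have one: "ennreal (\<bar>f x\<bar> / (3 * sqrt N)) \<le> W \<omega>" if \<omega>: "\<omega> \<in> B" for \<omega>
      proof (cases "norm x < R")
        case False
        then show ?thesis using supp by simp
      next
        case True
        have "norm (M *\<^sub>R \<omega>) \<ge> 2 * R" using Bn[OF \<omega>] R by (simp add: M_def)
        then have "norm (x + M *\<^sub>R \<omega>) \<ge> R"
          using True norm_triangle_ineq4[of "x + M *\<^sub>R \<omega>" x] by simp
        then have z: "f (x + M *\<^sub>R \<omega>) = 0" using supp by simp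
        have "ennreal (\<bar>f x\<bar> / (3 * sqrt N)) = ennreal (1 / (3 * sqrt N)) * ennreal \<bar>f x\<bar>"
          using N by (simp add: ennreal_mult[symmetric])
        also have "\<dots> \<le> ennreal (1 / (3 * sqrt N)) *
            (\<integral>\<^sup>+t. ennreal (norm \<omega> * norm (Df (x + t *\<^sub>R \<omega>))) * indicator {0<..M} t \<partial>lborel)"
          using M by (intro mult_left_mono C1_fun_ray_bound[OF f _ z]) auto
        also have "\<dots> = (\<integral>\<^sup>+t. ennreal (1 / (3 * sqrt N)) *
            (ennreal (norm \<omega> * norm (Df (x + t *\<^sub>R \<omega>))) * indicator {0<..M} t) \<partial>lborel)"
          by (rule nn_integral_cmult[symmetric]) measurable
        also have "\<dots> \<le> W \<omega>"
          unfolding W_def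
        proof (rule nn_integral_mono)
          fix t :: real
          show "ennreal (1 / (3 * sqrt N)) *
             (ennreal (norm \<omega> * norm (Df (x + t *\<^sub>R \<omega>))) * indicator {0<..M} t)
             \<le> ennreal (\<sigma> powr (1 - p)) * (T \<beta> t * g (x + t *\<^sub>R \<omega>))
            + ennreal \<sigma> * (T \<gamma> t * g (x + t *\<^sub>R \<omega>) + T (- \<delta>) t)"
          proof (cases "t \<in> {0<..M}")
            case t: True
            have "norm \<omega> * norm (Df (x + t *\<^sub>R \<omega>)) \<le> 3 * norm (Df (x + t *\<^sub>R \<omega>))"
              using Bn[OF \<omega>] by (intro mult_right_mono) auto
            then have "1 / (3 * sqrt N) * (norm \<omega> * norm (Df (x + t *\<^sub>R \<omega>))) \<le> d (x + t *\<^sub>R \<omega>)"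
              using N by (simp add: d_def field_simps)
            also have "\<dots> \<le> \<sigma> powr (1 - p) * (t powr \<beta> * (d (x + t *\<^sub>R \<omega>))\<^sup>2)
               + \<sigma> * (t powr \<gamma> * (d (x + t *\<^sub>R \<omega>))\<^sup>2 + t powr (- \<delta>))"
              using t by (intro young_kernel_bound p d0 \<sigma> \<beta>2) auto
            finally have "ennreal (1 / (3 * sqrt N) * (norm \<omega> * norm (Df (x + t *\<^sub>R \<omega>)))) \<le>
              ennreal (\<sigma> powr (1 - p) * (t powr \<beta> * (d (x + t *\<^sub>R \<omega>))\<^sup>2)
               + \<sigma> * (t powr \<gamma> * (d (x + t *\<^sub>R \<omega>))\<^sup>2 + t powr (- \<delta>)))" by (rule ennreal_leI)
            then show ?thesis using t \<sigma> N unfolding T_def g_def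
              by (simp add: ennreal_mult ennreal_plus del: times_divide_eq_left)
          qed (simp add: T_def)
        qed
        finally show ?thesis .
      qed
      have "ennreal (y x) = (\<integral>\<^sup>+\<omega>. ennreal (\<bar>f x\<bar> / (3 * sqrt N)) * indicator B \<omega> \<partial>lborel)"
        using N b by (subst nn_integral_cmult_indicator) (simp_all add: eb y_def ennreal_mult[symmetric])
      also have "\<dots> \<le> (\<integral>\<^sup>+\<omega>. indicator B \<omega> * W \<omega> \<partial>lborel)"
        using one by (intro nn_integral_mono) (auto simp: indicator_def)
      also have "\<dots> = (\<integral>\<^sup>+\<omega>. ennreal (\<sigma> powr (1 - p)) * (indicator B \<omega> * (\<integral>\<^sup>+t. T \<beta> t * g (x + t *\<^sub>R \<omega>) \<partial>lborel))
          + ennreal \<sigma> * (indicator B \<omega> * (\<integral>\<^sup>+t. T \<gamma> t * g (x + t *\<^sub>R \<omega>) \<partial>lborel) + ennreal (P (- \<delta>)) * indicator B \<omega>) \<partial>lborel)"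
      proof (rule nn_integral_cong)
        fix \<omega>
        have "W \<omega> = ennreal (\<sigma> powr (1 - p)) * (\<integral>\<^sup>+t. T \<beta> t * g (x + t *\<^sub>R \<omega>) \<partial>lborel)
          + ennreal \<sigma> * ((\<integral>\<^sup>+t. T \<gamma> t * g (x + t *\<^sub>R \<omega>) \<partial>lborel) + ennreal (P (- \<delta>)))"
          unfolding W_def using TI[OF \<delta>1] by (simp add: nn_integral_add nn_integral_cmult)
        then show "indicator B \<omega> * W \<omega> = ennreal (\<sigma> powr (1 - p)) * (indicator B \<omega> * (\<integral>\<^sup>+t. T \<beta> t * g (x + t *\<^sub>R \<omega>) \<partial>lborel))
          + ennreal \<sigma> * (indicator B \<omega> * (\<integral>\<^sup>+t. T \<gamma> t * g (x + t *\<^sub>R \<omega>) \<partial>lborel) + ennreal (P (- \<delta>)) * indicator B \<omega>)"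
          by (auto simp: indicator_def)
      qed
      also have "\<dots> = ennreal (\<sigma> powr (1 - p)) * X x
          + ennreal \<sigma> * ((\<integral>\<^sup>+\<omega>. indicator B \<omega> * (\<integral>\<^sup>+t. T \<gamma> t * g (x + t *\<^sub>R \<omega>) \<partial>lborel) \<partial>lborel) + ennreal (P (- \<delta>)) * ennreal b)"
        unfolding X_def by (simp add: nn_integral_add nn_integral_cmult nn_integral_cmult_indicator eb)
      also have "\<dots> \<le> ennreal (\<sigma> powr (1 - p)) * X x + ennreal \<sigma> * (ennreal (P (\<gamma> - n)) + ennreal (P (- \<delta>)) * ennreal b)"
      proof (intro add_mono mult_left_mono order_refl)
        have "(\<integral>\<^sup>+\<omega>. indicator B \<omega> * (\<integral>\<^sup>+t. T \<gamma> t * g (x + t *\<^sub>R \<omega>) \<partial>lborel) \<partial>lborel)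
          \<le> (\<integral>\<^sup>+\<omega>. (\<integral>\<^sup>+t. T \<gamma> t * g (x + t *\<^sub>R \<omega>) \<partial>lborel) \<partial>lborel)"
          by (intro nn_integral_mono) (auto simp: indicator_def)
        also have "\<dots> = (\<integral>\<^sup>+t. (\<integral>\<^sup>+\<omega>. T \<gamma> t * g (x + t *\<^sub>R \<omega>) \<partial>lborel) \<partial>lborel)"
          by (rule lborel_pair.Fubini') measurable
        \<comment> \<open>For fixed t the substitution x + t \<omega> contributes t^(-n), which
          lowers the exponent \<gamma> to \<gamma> - n; this is the origin of the requirement
          \<gamma> > n - 1.\<close>
        also have "\<dots> \<le> (\<integral>\<^sup>+t. T (\<gamma> - n) t \<partial>lborel)"
        proof (rule nn_integral_mono)
          fix t :: real
          show "(\<integral>\<^sup>+\<omega>. T \<gamma> t * g (x + t *\<^sub>R \<omega>) \<partial>lborel) \<le> T (\<gamma> - n) t"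
          proof (cases "t \<in> {0<..M}")
            case t: True
            have "(\<integral>\<^sup>+\<omega>. T \<gamma> t * g (x + t *\<^sub>R \<omega>) \<partial>lborel) = T \<gamma> t * (\<integral>\<^sup>+\<omega>. g (x + t *\<^sub>R \<omega>) \<partial>lborel)"
              by (rule nn_integral_cmult) measurable
            also have "\<dots> = T \<gamma> t * (ennreal (1 / \<bar>t\<bar> ^ DIM(real^'n)) * (\<integral>\<^sup>+y. g y \<partial>lborel))"
              using t by (subst nn_integral_lborel_affine[OF gm]) auto
            also have "\<dots> \<le> T \<gamma> t * (ennreal (1 / \<bar>t\<bar> ^ DIM(real^'n)) * 1)"
              by (intro mult_left_mono g1) auto
            also have "\<dots> = T (\<gamma> - n) t"
              using t by (simp add: T_def n_def ennreal_mult[symmetric] powr_diff powr_realpow)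
            finally show ?thesis .
          qed (simp add: T_def)
        qed
        also have "\<dots> = ennreal (P (\<gamma> - n))" by (rule TI[OF \<gamma>1])
        finally show "(\<integral>\<^sup>+\<omega>. indicator B \<omega> * (\<integral>\<^sup>+t. T \<gamma> t * g (x + t *\<^sub>R \<omega>) \<partial>lborel) \<partial>lborel) \<le> ennreal (P (\<gamma> - n))" .
      qed auto
      also have "ennreal (P (\<gamma> - n)) + ennreal (P (- \<delta>)) * ennreal b = ennreal K0"
        unfolding K0_def using P0[OF \<delta>1] P0[OF \<gamma>1] b
        by (simp add: ennreal_plus ennreal_mult mult.commute)
      finally show ?thesis using \<sigma> K0 by (simp add: ennreal_mult)
    qed
    \<comment> \<open>Only an almost everywhere finite \<open>X\<close> can be expected pointwise,
      so the infinite value is treated separately; there the bound is trivial.\<close>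
    have yX: "ennreal (y x powr p) \<le> ennreal (2 * (2 * K0) powr (p - 1)) * X x" for x
    proof (cases "X x")
      case (real r)
      have "y x powr p \<le> 2 * (2 * K0) powr (p - 1) * r"
      proof (rule powr_le_of_young_family)
        fix \<sigma> :: real assume \<sigma>: "\<sigma> > 0"
        have "ennreal (y x) \<le> ennreal (\<sigma> powr (1 - p) * r + \<sigma> * K0)"
          using key[OF \<sigma>, of x] real \<sigma> K0 by (simp add: ennreal_mult ennreal_plus)
        then show "y x \<le> \<sigma> powr (1 - p) * r + \<sigma> * K0"
          using real \<sigma> K0 by (subst (asm) ennreal_le_iff) auto
      qed (use p y0 real K0 in auto)
      then show ?thesis using real by (simp add: ennreal_mult[symmetric] ennreal_leI)
    next
      case top
      then show ?thesis using K0 by (simp add: ennreal_mult_top)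
    qed
    \<comment> \<open>With the x-integral innermost, translation invariance gives a bound free of t
      and \<omega>, so the weight t^\<beta> with \<beta> > -1 is already integrable.\<close>
    have XI: "(\<integral>\<^sup>+x. X x \<partial>lborel) \<le> ennreal (b * P \<beta>)"
    proof -
      have "(\<integral>\<^sup>+x. X x \<partial>lborel) =
         (\<integral>\<^sup>+\<omega>. (\<integral>\<^sup>+x. indicator B \<omega> * (\<integral>\<^sup>+t. T \<beta> t * g (x + t *\<^sub>R \<omega>) \<partial>lborel) \<partial>lborel) \<partial>lborel)"
        unfolding X_def by (rule lborel_pair.Fubini') measurable
      also have "\<dots> \<le> (\<integral>\<^sup>+\<omega>. ennreal (P \<beta>) * indicator B \<omega> \<partial>lborel)"
      proof (rule nn_integral_mono)
        fix \<omega> :: "real^'n"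
        have "(\<integral>\<^sup>+x. (\<integral>\<^sup>+t. T \<beta> t * g (x + t *\<^sub>R \<omega>) \<partial>lborel) \<partial>lborel)
           = (\<integral>\<^sup>+t. (\<integral>\<^sup>+x. T \<beta> t * g (x + t *\<^sub>R \<omega>) \<partial>lborel) \<partial>lborel)"
          by (rule lborel_pair.Fubini') measurable
        also have "\<dots> \<le> (\<integral>\<^sup>+t. T \<beta> t \<partial>lborel)"
        proof (rule nn_integral_mono)
          fix t :: real
          have "(\<integral>\<^sup>+x. T \<beta> t * g (x + t *\<^sub>R \<omega>) \<partial>lborel) = T \<beta> t * (\<integral>\<^sup>+x. g (x + t *\<^sub>R \<omega>) \<partial>lborel)"
            by (rule nn_integral_cmult) measurable
          also have "(\<integral>\<^sup>+x. g (x + t *\<^sub>R \<omega>) \<partial>lborel) = (\<integral>\<^sup>+x. g x \<partial>lborel)"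
            using nn_integral_lborel_affine[OF gm, of 1 "t *\<^sub>R \<omega>"] by (simp add: add.commute)
          also have "T \<beta> t * \<dots> \<le> T \<beta> t * 1" by (intro mult_left_mono g1) auto
          finally show "(\<integral>\<^sup>+x. T \<beta> t * g (x + t *\<^sub>R \<omega>) \<partial>lborel) \<le> T \<beta> t" by simp
        qed
        also have "\<dots> = ennreal (P \<beta>)" by (rule TI[OF \<beta>1])
        finally show "(\<integral>\<^sup>+x. indicator B \<omega> * (\<integral>\<^sup>+t. T \<beta> t * g (x + t *\<^sub>R \<omega>) \<partial>lborel) \<partial>lborel) \<le> ennreal (P \<beta>) * indicator B \<omega>"
          by (cases "\<omega> \<in> B") auto
      qed
      also have "\<dots> = ennreal (b * P \<beta>)"
        using P0[OF \<beta>1] b by (subst nn_integral_cmult_indicator) (simp_all add: eb ennreal_mult[symmetric] mult.commute)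
      finally show ?thesis .
    qed
    have Xm[measurable]: "X \<in> borel_measurable borel" unfolding X_def by measurable
    define c where "c = (3 * sqrt N / b) powr p"
    have fy: "\<bar>f x\<bar> powr p = c * y x powr p" for x
    proof -
      have "\<bar>f x\<bar> = (3 * sqrt N / b) * y x" using N b by (simp add: y_def)
      then show ?thesis unfolding c_def using N b y0 by (metis powr_mult)
    qed
    have "(\<integral>\<^sup>+x. ennreal (\<bar>f x\<bar> powr p) \<partial>lborel)
       \<le> (\<integral>\<^sup>+x. ennreal (c * (2 * (2 * K0) powr (p - 1))) * X x \<partial>lborel)"
    proof (rule nn_integral_mono)
      fix x
      have "ennreal (\<bar>f x\<bar> powr p) = ennreal c * ennreal (y x powr p)"
        unfolding fy by (simp add: ennreal_mult c_def)
      also have "\<dots> \<le> ennreal c * (ennreal (2 * (2 * K0) powr (p - 1)) * X x)"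
        by (intro mult_left_mono yX) auto
      also have "\<dots> = ennreal (c * (2 * (2 * K0) powr (p - 1))) * X x"
        by (simp add: ennreal_mult c_def mult.assoc)
      finally show "ennreal (\<bar>f x\<bar> powr p) \<le> ennreal (c * (2 * (2 * K0) powr (p - 1))) * X x" .
    qed
    also have "\<dots> = ennreal (c * (2 * (2 * K0) powr (p - 1))) * (\<integral>\<^sup>+x. X x \<partial>lborel)"
      by (rule nn_integral_cmult) measurable
    also have "\<dots> \<le> ennreal (c * (2 * (2 * K0) powr (p - 1))) * ennreal (b * P \<beta>)"
      by (intro mult_left_mono XI) auto
    also have "\<dots> = ennreal (A * N powr (p / 2))"
    proof -
      have "c = (3 / b) powr p * N powr (p / 2)"
      proof -
        have "3 * sqrt N / b = (3 / b) * N powr (1/2)" using N by (simp add: powr_half_sqrt)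
        then have "c = (3 / b) powr p * (N powr (1/2)) powr p" unfolding c_def using b by (simp only: powr_mult)
        then show ?thesis by (simp add: powr_powr)
      qed
      then have "c * (2 * (2 * K0) powr (p - 1)) * (b * P \<beta>) = A * N powr (p / 2)"
        unfolding A_def by (simp only: mult_ac)
      then show ?thesis using b P0[OF \<beta>1] by (subst ennreal_mult[symmetric]) (auto simp: c_def)
    qed
    finally show "(\<integral>\<^sup>+x. ennreal (\<bar>f x\<bar> powr p) \<partial>lborel) \<le> ennreal (A * N powr (p / 2))" .
  qed
qed

section \<open>From C^1 test functions to H_0^1 by approximation\<close>

lemma wgrad_spec:
  assumes "H01 \<Omega> u"
  shows "L2v \<Omega> (wgrad \<Omega> u)" "weak_grad \<Omega> u (wgrad \<Omega> u)"
proof -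
  have "\<exists>g. L2v \<Omega> g \<and> weak_grad \<Omega> u g" using assms unfolding H01_def by blast
  from someI_ex[OF this] show "L2v \<Omega> (wgrad \<Omega> u)" "weak_grad \<Omega> u (wgrad \<Omega> u)"
    unfolding wgrad_def by auto
qed

text \<open>Frees the gradient norm from the choice made by \<open>SOME\<close>, so that it can be
  computed with the gradient that test functions approximate.\<close>

lemma grad_norm2_eq:
  fixes \<Omega> :: "(real^'n) set"
  assumes "open \<Omega>" "bounded \<Omega>" "H01 \<Omega> u" "L2v \<Omega> g" "weak_grad \<Omega> u g"
  shows "grad_norm2 \<Omega> u = (LINT x:\<Omega>|lborel. (norm (g x))\<^sup>2)"
proof -
  note w = wgrad_spec[OF assms(3)]
  have [measurable]: "wgrad \<Omega> u \<in> borel_measurable lborel" "g \<in> borel_measurable lborel"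
    using w(1) assms(4) by (auto simp: L2v_def)
  show ?thesis unfolding grad_norm2_def
  proof (rule set_lebesgue_integral_cong_AE)
    show "AE x\<in>\<Omega> in lborel. (norm (wgrad \<Omega> u x))\<^sup>2 = (norm (g x))\<^sup>2"
      using weak_grad_AE_unique[OF assms(1,2) w assms(4,5)] by eventually_elim auto
  qed (use assms(1) in auto)
qed

text \<open>A small \<eta> keeps the factor of |a|^2 near 1. That lets the approximants stay below
  any bound strictly above the limiting gradient norm.\<close>

lemma sum_square_le:
  fixes a b :: "'a::real_normed_vector"
  assumes "\<eta> > 0"
  shows "(norm (a + b))\<^sup>2 \<le> (1 + \<eta>) * (norm a)\<^sup>2 + (1 + 1 / \<eta>) * (norm b)\<^sup>2"
proof -
  have "(norm (a + b))\<^sup>2 \<le> (norm a + norm b)\<^sup>2" by (intro power_mono norm_triangle_ineq) auto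
  also have "\<dots> = (norm a)\<^sup>2 + (norm b)\<^sup>2 + 2 * norm a * norm b" by (simp add: power2_sum)
  also have "2 * norm a * norm b \<le> \<eta> * (norm a)\<^sup>2 + (1 / \<eta>) * (norm b)\<^sup>2"
  proof -
    have "0 \<le> (\<eta> * norm a - norm b)\<^sup>2 / \<eta>" using assms by simp
    also have "\<dots> = \<eta> * (norm a)\<^sup>2 + (1 / \<eta>) * (norm b)\<^sup>2 - 2 * norm a * norm b"
      using assms by (simp add: power2_eq_square field_simps)
    finally show ?thesis by simp
  qed
  finally show ?thesis by (simp add: algebra_simps)
qed

lemma is_test_L2:
  fixes \<Omega> :: "(real^'n) set"
  assumes "open \<Omega>" "bounded \<Omega>" "is_test \<Omega> \<phi> D\<phi>"
  shows "set_integrable lborel \<Omega> (\<lambda>x. (\<phi> x)\<^sup>2)" "set_integrable lborel \<Omega> (\<lambda>x. (norm (D\<phi> x))\<^sup>2)"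
proof -
  obtain B where B: "B \<ge> 0" "\<And>x. \<bar>\<phi> x\<bar> \<le> B" "\<And>x. norm (D\<phi> x) \<le> B" using is_test_bounded[OF assms(3)] by metis
  have [measurable]: "\<phi> \<in> borel_measurable borel" "D\<phi> \<in> borel_measurable borel" "\<Omega> \<in> sets borel"
    using is_test_borel[OF assms(3)] assms(1) by auto
  have fin: "set_integrable lborel \<Omega> (\<lambda>x. B\<^sup>2)"
    using emeasure_bounded_finite[OF assms(2)] unfolding set_integrable_def by simp
  have "(\<phi> x)\<^sup>2 \<le> B\<^sup>2" for x using power_mono[OF B(2)[of x], of 2] by simp
  then show "set_integrable lborel \<Omega> (\<lambda>x. (\<phi> x)\<^sup>2)"
    by (intro set_integrable_bound[OF fin]) (auto simp: set_borel_measurable_def)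
  have "(norm (D\<phi> x))\<^sup>2 \<le> B\<^sup>2" for x using power_mono[OF B(3)[of x], of 2] by simp
  then show "set_integrable lborel \<Omega> (\<lambda>x. (norm (D\<phi> x))\<^sup>2)"
    by (intro set_integrable_bound[OF fin]) (auto simp: set_borel_measurable_def)
qed

lemma H01_approx:
  fixes \<Omega> :: "(real^'n) set"
  assumes \<Omega>: "open \<Omega>" "bounded \<Omega>" and u: "H01 \<Omega> u" and N: "grad_norm2 \<Omega> u < N"
  obtains \<phi> D\<phi> where "\<And>k::nat. is_test \<Omega> (\<phi> k) (D\<phi> k)"
    "\<And>k. (\<integral>\<^sup>+x. ennreal ((norm (D\<phi> k x))\<^sup>2) \<partial>lborel) \<le> ennreal N"
    "AE x in lborel. x \<in> \<Omega> \<longrightarrow> (\<lambda>k. \<phi> k x) \<longlonglongrightarrow> u x"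
proof -
  obtain g where g: "L2v \<Omega> g" "weak_grad \<Omega> u g" and app: "\<And>\<epsilon>. \<epsilon> > 0 \<Longrightarrow> \<exists>\<phi> D\<phi>. is_test \<Omega> \<phi> D\<phi> \<and>
         (LINT x:\<Omega>|lborel. (u x - \<phi> x)\<^sup>2 + (norm (g x - D\<phi> x))\<^sup>2) < \<epsilon>"
    using u unfolding H01_def by blast
  define G where "G = (LINT x:\<Omega>|lborel. (norm (g x))\<^sup>2)"
  have G: "G < N" "G \<ge> 0" using N grad_norm2_eq[OF \<Omega> u g]
    by (auto simp: G_def set_lebesgue_integral_def intro!: Bochner_Integration.integral_nonneg)
  have [measurable]: "u \<in> borel_measurable borel" "g \<in> borel_measurable borel" "\<Omega> \<in> sets borel"
    using u g \<Omega> by (auto simp: H01_def L2_def L2v_def)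
  have i: "set_integrable lborel \<Omega> (\<lambda>x. (u x)\<^sup>2)" "set_integrable lborel \<Omega> (\<lambda>x. (norm (g x))\<^sup>2)"
    using u g by (auto simp: H01_def L2_def L2v_def)
  \<comment> \<open>The gap N - G is spent in two halves: \<eta> covers the inflated gradient of the
    limit, \<rho> the approximation error. The denominator has G + 1 because G may be 0.\<close>
  define \<eta> where "\<eta> = (N - G) / (2 * (G + 1))"
  have \<eta>: "\<eta> > 0" using G by (simp add: \<eta>_def)
  define \<rho> where "\<rho> = (N - G) / (2 * (1 + 1 / \<eta>))"
  have \<eta>1: "1 + 1 / \<eta> > 0" using \<eta> by (simp add: add_pos_pos)
  have \<rho>: "\<rho> > 0" unfolding \<rho>_def using G \<eta>1 by (intro divide_pos_pos mult_pos_pos) auto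
  have bud: "(1 + \<eta>) * G + (1 + 1 / \<eta>) * \<rho> \<le> N"
  proof -
    have half: "c * ((N - G) / (2 * c)) = (N - G) / 2" if "c > 0" for c :: real using that by simp
    from half[OF \<eta>1] have "(1 + 1 / \<eta>) * \<rho> = (N - G) / 2" unfolding \<rho>_def .
    moreover have "(G + 1) * \<eta> = (N - G) / 2" unfolding \<eta>_def using G by (intro half) simp
    moreover have "\<eta> * G \<le> \<eta> * (G + 1)" using \<eta> by simp
    ultimately show ?thesis by (simp add: algebra_simps)
  qed
  have "\<forall>k. \<exists>z. is_test \<Omega> (fst z) (snd z) \<and>
         (LINT x:\<Omega>|lborel. (u x - fst z x)\<^sup>2 + (norm (g x - snd z x))\<^sup>2) < min \<rho> (1 / real (Suc k))"
  proof
    fix k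
    have "min \<rho> (1 / real (Suc k)) > 0" using \<rho> by simp
    from app[OF this] show "\<exists>z. is_test \<Omega> (fst z) (snd z) \<and>
         (LINT x:\<Omega>|lborel. (u x - fst z x)\<^sup>2 + (norm (g x - snd z x))\<^sup>2) < min \<rho> (1 / real (Suc k))"
    proof (elim exE)
      fix \<phi> D\<phi>
      assume "is_test \<Omega> \<phi> D\<phi> \<and> (LINT x:\<Omega>|lborel. (u x - \<phi> x)\<^sup>2 + (norm (g x - D\<phi> x))\<^sup>2) < min \<rho> (1 / real (Suc k))"
      then show ?thesis by (intro exI[of _ "(\<phi>, D\<phi>)"]) (simp only: fst_conv snd_conv)
    qed
  qed
  from choice[OF this] obtain z where z: "\<forall>k. is_test \<Omega> (fst (z k)) (snd (z k)) \<and>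
         (LINT x:\<Omega>|lborel. (u x - fst (z k) x)\<^sup>2 + (norm (g x - snd (z k) x))\<^sup>2) < min \<rho> (1 / real (Suc k))" ..
  define \<phi> D\<phi> where "\<phi> = (\<lambda>k. fst (z k))" and "D\<phi> = (\<lambda>k. snd (z k))"
  have t: "is_test \<Omega> (\<phi> k) (D\<phi> k)" and
    l: "(LINT x:\<Omega>|lborel. (u x - \<phi> k x)\<^sup>2 + (norm (g x - D\<phi> k x))\<^sup>2) < min \<rho> (1 / real (Suc k))" for k
    using z unfolding \<phi>_def D\<phi>_def by blast+
  have m[measurable]: "\<phi> k \<in> borel_measurable borel" "D\<phi> k \<in> borel_measurable borel" for k
    using is_test_borel[OF t] by auto
  have ab: "(a - b)\<^sup>2 \<le> 2 * a\<^sup>2 + 2 * b\<^sup>2" for a b :: real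
    using sum_square_le[of 1 a "- b"] by simp
  have abv: "(norm (a - b))\<^sup>2 \<le> 2 * (norm a)\<^sup>2 + 2 * (norm b)\<^sup>2" for a b :: "real^'n"
    using sum_square_le[of 1 a "- b"] by simp
  \<comment> \<open>The Bochner integral of a non-integrable function is 0, so smallness of the
    integral in \<open>H01\<close> says nothing until integrability is established.\<close>
  have i1: "set_integrable lborel \<Omega> (\<lambda>x. (u x - \<phi> k x)\<^sup>2)" for k
  proof (rule set_integrable_bound)
    show "set_integrable lborel \<Omega> (\<lambda>x. 2 * (u x)\<^sup>2 + 2 * (\<phi> k x)\<^sup>2)"
      using i(1) is_test_L2(1)[OF \<Omega> t] by (intro set_integral_add set_integrable_mult_right) auto
    show "AE x in lborel. x \<in> \<Omega> \<longrightarrow> norm ((u x - \<phi> k x)\<^sup>2) \<le> norm (2 * (u x)\<^sup>2 + 2 * (\<phi> k x)\<^sup>2)"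
      using ab by (intro AE_I2) (simp add: abs_of_nonneg)
  qed (simp add: set_borel_measurable_def)
  have i2: "set_integrable lborel \<Omega> (\<lambda>x. (norm (g x - D\<phi> k x))\<^sup>2)" for k
  proof (rule set_integrable_bound)
    show "set_integrable lborel \<Omega> (\<lambda>x. 2 * (norm (g x))\<^sup>2 + 2 * (norm (D\<phi> k x))\<^sup>2)"
      using i(2) is_test_L2(2)[OF \<Omega> t] by (intro set_integral_add set_integrable_mult_right) auto
    show "AE x in lborel. x \<in> \<Omega> \<longrightarrow> norm ((norm (g x - D\<phi> k x))\<^sup>2) \<le> norm (2 * (norm (g x))\<^sup>2 + 2 * (norm (D\<phi> k x))\<^sup>2)"
      using abv by (intro AE_I2) (simp add: abs_of_nonneg)
  qed (simp add: set_borel_measurable_def)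
  have s: "(LINT x:\<Omega>|lborel. (u x - \<phi> k x)\<^sup>2 + (norm (g x - D\<phi> k x))\<^sup>2)
      = (LINT x:\<Omega>|lborel. (u x - \<phi> k x)\<^sup>2) + (LINT x:\<Omega>|lborel. (norm (g x - D\<phi> k x))\<^sup>2)" for k
    by (rule set_integral_add(2)[OF i1 i2])
  have nn: "(LINT x:\<Omega>|lborel. (u x - \<phi> k x)\<^sup>2) \<ge> 0" "(LINT x:\<Omega>|lborel. (norm (g x - D\<phi> k x))\<^sup>2) \<ge> 0" for k
    by (auto simp: set_lebesgue_integral_def intro!: Bochner_Integration.integral_nonneg)
  have l1: "(LINT x:\<Omega>|lborel. (u x - \<phi> k x)\<^sup>2) \<le> 1 / real (Suc k)" for k
    using l[of k] nn[of k] s[of k] by linarith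
  have l2: "(LINT x:\<Omega>|lborel. (norm (g x - D\<phi> k x))\<^sup>2) \<le> \<rho>" for k
    using l[of k] nn[of k] s[of k] by linarith
  have D: "(\<integral>\<^sup>+x. ennreal ((norm (D\<phi> k x))\<^sup>2) \<partial>lborel) \<le> ennreal N" for k
  proof -
    have z: "D\<phi> k x = 0" if "x \<notin> \<Omega>" for x
      using is_test_grad_zero[OF t, of x k] t[of k] that unfolding is_test_def by blast
    have "(\<integral>\<^sup>+x. ennreal ((norm (D\<phi> k x))\<^sup>2) \<partial>lborel) = (\<integral>\<^sup>+x. ennreal (indicator \<Omega> x *\<^sub>R (norm (D\<phi> k x))\<^sup>2) \<partial>lborel)"
      by (intro nn_integral_cong) (use z in \<open>auto simp: indicator_def\<close>)
    also have "\<dots> = ennreal (LINT x:\<Omega>|lborel. (norm (D\<phi> k x))\<^sup>2)"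
      using is_test_L2(2)[OF \<Omega> t[of k]] unfolding set_lebesgue_integral_def set_integrable_def
      by (intro nn_integral_eq_integral) auto
    also have "(LINT x:\<Omega>|lborel. (norm (D\<phi> k x))\<^sup>2)
       \<le> (LINT x:\<Omega>|lborel. (1 + \<eta>) * (norm (g x))\<^sup>2 + (1 + 1 / \<eta>) * (norm (g x - D\<phi> k x))\<^sup>2)"
    proof (rule set_integral_mono)
      show "(norm (D\<phi> k x))\<^sup>2 \<le> (1 + \<eta>) * (norm (g x))\<^sup>2 + (1 + 1 / \<eta>) * (norm (g x - D\<phi> k x))\<^sup>2" for x
        using sum_square_le[OF \<eta>, of "g x" "D\<phi> k x - g x"] by (simp add: norm_minus_commute)
      show "set_integrable lborel \<Omega> (\<lambda>x. (1 + \<eta>) * (norm (g x))\<^sup>2 + (1 + 1 / \<eta>) * (norm (g x - D\<phi> k x))\<^sup>2)"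
        using i(2) i2 by (intro set_integral_add set_integrable_mult_right) auto
    qed (rule is_test_L2(2)[OF \<Omega> t])
    also have "\<dots> = (1 + \<eta>) * G + (1 + 1 / \<eta>) * (LINT x:\<Omega>|lborel. (norm (g x - D\<phi> k x))\<^sup>2)"
      using i(2) i2 by (subst set_integral_add(2)) (auto simp: G_def)
    also have "\<dots> \<le> (1 + \<eta>) * G + (1 + 1 / \<eta>) * \<rho>"
      using l2 \<eta>1 by (intro add_left_mono mult_left_mono) auto
    also note bud
    finally show ?thesis by (simp add: ennreal_leI)
  qed
  \<comment> \<open>L^1 convergence gives pointwise convergence only along a subsequence; the
    gradient bound holds for every index and therefore survives.\<close>
  have "\<exists>r. strict_mono r \<and> (AE x in lborel. (\<lambda>k. indicator \<Omega> x *\<^sub>R (u x - \<phi> (r k) x)\<^sup>2) \<longlonglongrightarrow> 0)"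
  proof (rule tendsto_L1_AE_subseq)
    show "integrable lborel (\<lambda>x. indicator \<Omega> x *\<^sub>R (u x - \<phi> k x)\<^sup>2)" for k
      using i1[of k] by (simp add: set_integrable_def)
    have eq: "(LINT x|lborel. norm (indicator \<Omega> x *\<^sub>R (u x - \<phi> k x)\<^sup>2)) = (LINT x:\<Omega>|lborel. (u x - \<phi> k x)\<^sup>2)" for k
      unfolding set_lebesgue_integral_def by simp
    show "(\<lambda>k. LINT x|lborel. norm (indicator \<Omega> x *\<^sub>R (u x - \<phi> k x)\<^sup>2)) \<longlonglongrightarrow> 0"
      unfolding eq
    proof (rule tendsto_sandwich[OF _ _ tendsto_const LIMSEQ_inverse_real_of_nat])
      show "\<forall>\<^sub>F k in sequentially. (LINT x:\<Omega>|lborel. (u x - \<phi> k x)\<^sup>2) \<le> inverse (real (Suc k))"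
        using l1 by (simp add: inverse_eq_divide)
    qed (use nn in auto)
  qed
  then obtain r where r: "strict_mono r" "AE x in lborel. (\<lambda>k. indicator \<Omega> x *\<^sub>R (u x - \<phi> (r k) x)\<^sup>2) \<longlonglongrightarrow> 0"
    by blast
  have "AE x in lborel. x \<in> \<Omega> \<longrightarrow> (\<lambda>k. \<phi> (r k) x) \<longlonglongrightarrow> u x"
    using r(2)
  proof (eventually_elim, intro impI)
    fix x assume "(\<lambda>k. indicator \<Omega> x *\<^sub>R (u x - \<phi> (r k) x)\<^sup>2) \<longlonglongrightarrow> 0" "x \<in> \<Omega>"
    then have "(\<lambda>k. (u x - \<phi> (r k) x)\<^sup>2) \<longlonglongrightarrow> 0" by simp
    from tendsto_real_sqrt[OF this] have "(\<lambda>k. \<bar>u x - \<phi> (r k) x\<bar>) \<longlonglongrightarrow> 0" by simp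
    then have "(\<lambda>k. u x - \<phi> (r k) x) \<longlonglongrightarrow> 0" by (rule tendsto_rabs_zero_cancel)
    from tendsto_diff[OF tendsto_const[of "u x"] this] show "(\<lambda>k. \<phi> (r k) x) \<longlonglongrightarrow> u x" by simp
  qed
  then show ?thesis using that[of "\<lambda>k. \<phi> (r k)" "\<lambda>k. D\<phi> (r k)"] t D by blast
qed

text \<open>The estimate is first shown with each N strictly above the gradient norm, where
  approximants with gradient bound N exist, and then N decreases to it. This also covers gradient
  norm 0.\<close>

lemma H01_sobolev:
  fixes \<Omega> :: "(real^'n) set"
  assumes \<Omega>: "open \<Omega>" "bounded \<Omega>"
    and p: "p > 2" and sub: "p * (real CARD('n) - 2) < 2 * real CARD('n)"
  shows "\<exists>C\<ge>0. \<forall>u. H01 \<Omega> u \<longrightarrow> Lp_norm \<Omega> p u \<le> C * sqrt (grad_norm2 \<Omega> u)"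
proof -
  obtain R0 where R0: "\<And>x. x \<in> \<Omega> \<Longrightarrow> norm x \<le> R0" using \<Omega>(2) bounded_iff by blast
  define R where "R = \<bar>R0\<bar> + 1"
  have R: "R > 0" "\<And>x. x \<in> \<Omega> \<Longrightarrow> norm x < R" using R0 unfolding R_def by force+
  obtain K where K: "K > 0" and sob': "\<forall>(f :: real^'n \<Rightarrow> real) Df N. C1_fun f Df \<longrightarrow> (\<forall>x. norm x \<ge> R \<longrightarrow> f x = 0) \<longrightarrow> N > 0 \<longrightarrow>
     (\<integral>\<^sup>+x. ennreal ((norm (Df x))\<^sup>2) \<partial>lborel) \<le> ennreal N \<longrightarrow>
     (\<integral>\<^sup>+x. ennreal (\<bar>f x\<bar> powr p) \<partial>lborel) \<le> ennreal (K * N powr (p / 2))"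
    using sobolev_C1[OF p sub R(1)] by blast
  note sob = sob'[rule_format]
  show ?thesis
  proof (intro exI[of _ "K powr (1 / p)"] conjI allI impI)
    fix u assume u: "H01 \<Omega> u"
    have G0: "grad_norm2 \<Omega> u \<ge> 0"
      by (auto simp: grad_norm2_def set_lebesgue_integral_def intro!: Bochner_Integration.integral_nonneg)
    have [measurable]: "u \<in> borel_measurable borel" "\<Omega> \<in> sets borel" using u \<Omega> by (auto simp: H01_def L2_def)
    have N: "Lp_norm \<Omega> p u \<le> K powr (1 / p) * sqrt N" if "grad_norm2 \<Omega> u < N" for N
    proof -
      have N0: "N > 0" using that G0 by simp
      obtain \<phi> D\<phi> where t: "\<And>k::nat. is_test \<Omega> (\<phi> k) (D\<phi> k)"
        and D: "\<And>k. (\<integral>\<^sup>+x. ennreal ((norm (D\<phi> k x))\<^sup>2) \<partial>lborel) \<le> ennreal N"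
        and lim: "AE x in lborel. x \<in> \<Omega> \<longrightarrow> (\<lambda>k. \<phi> k x) \<longlonglongrightarrow> u x"
        by (rule H01_approx[OF \<Omega> u \<open>grad_norm2 \<Omega> u < N\<close>]) blast
      have m[measurable]: "\<phi> k \<in> borel_measurable borel" for k using is_test_borel[OF t] by auto
      have bd: "(\<integral>\<^sup>+x. ennreal (\<bar>\<phi> k x\<bar> powr p) \<partial>lborel) \<le> ennreal (K * N powr (p / 2))" for k
      proof (rule sob[OF is_test_C1[OF t] _ N0 D])
        fix x :: "real^'n" assume "norm x \<ge> R"
        show "\<phi> k x = 0"
        proof (rule ccontr)
          assume "\<phi> k x \<noteq> 0"
          then have "x \<in> \<Omega>" using t[of k] closure_subset[of "{x. \<phi> k x \<noteq> 0}"] unfolding is_test_def by auto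
          then show False using R(2) \<open>norm x \<ge> R\<close> by force
        qed
      qed
      have "(\<integral>\<^sup>+x. ennreal (indicator \<Omega> x *\<^sub>R \<bar>u x\<bar> powr p) \<partial>lborel)
         \<le> (\<integral>\<^sup>+x. liminf (\<lambda>k. ennreal (\<bar>\<phi> k x\<bar> powr p)) \<partial>lborel)"
      proof (rule nn_integral_mono_AE)
        show "AE x in lborel. ennreal (indicator \<Omega> x *\<^sub>R \<bar>u x\<bar> powr p) \<le> liminf (\<lambda>k. ennreal (\<bar>\<phi> k x\<bar> powr p))"
          using lim
        proof eventually_elim
          fix x assume l: "x \<in> \<Omega> \<longrightarrow> (\<lambda>k. \<phi> k x) \<longlonglongrightarrow> u x"
          show "ennreal (indicator \<Omega> x *\<^sub>R \<bar>u x\<bar> powr p) \<le> liminf (\<lambda>k. ennreal (\<bar>\<phi> k x\<bar> powr p))"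
          proof (cases "x \<in> \<Omega>")
            case True
            then have "(\<lambda>k. \<bar>\<phi> k x\<bar>) \<longlonglongrightarrow> \<bar>u x\<bar>" using l by (simp add: tendsto_rabs)
            then have "(\<lambda>k. \<bar>\<phi> k x\<bar> powr p) \<longlonglongrightarrow> \<bar>u x\<bar> powr p"
              using p by (intro tendsto_powr'[OF _ tendsto_const]) auto
            then have "(\<lambda>k. ennreal (\<bar>\<phi> k x\<bar> powr p)) \<longlonglongrightarrow> ennreal (\<bar>u x\<bar> powr p)"
              by (rule tendsto_ennrealI)
            then have "liminf (\<lambda>k. ennreal (\<bar>\<phi> k x\<bar> powr p)) = ennreal (\<bar>u x\<bar> powr p)"
              by (intro lim_imp_Liminf) auto
            then show ?thesis using True by simp
          qed simp
        qed
      qed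
      also have "\<dots> \<le> liminf (\<lambda>k. (\<integral>\<^sup>+x. ennreal (\<bar>\<phi> k x\<bar> powr p) \<partial>lborel))"
        by (rule nn_integral_liminf) measurable
      also have "\<dots> \<le> ennreal (K * N powr (p / 2))"
        by (rule order_trans[OF Liminf_le_Limsup Limsup_bounded]) (use bd in auto)
      finally have "(LINT x:\<Omega>|lborel. \<bar>u x\<bar> powr p) \<le> K * N powr (p / 2)"
        unfolding set_lebesgue_integral_def using K by (intro integral_real_bounded) auto
      moreover have "(LINT x:\<Omega>|lborel. \<bar>u x\<bar> powr p) \<ge> 0"
        by (auto simp: set_lebesgue_integral_def intro!: Bochner_Integration.integral_nonneg)
      ultimately have "Lp_norm \<Omega> p u \<le> (K * N powr (p / 2)) powr (1 / p)"
        unfolding Lp_norm_def using p by (intro powr_mono2) auto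
      also have "\<dots> = K powr (1 / p) * sqrt N"
        using K N0 p by (simp add: powr_mult powr_powr powr_half_sqrt)
      finally show ?thesis .
    qed
    show "Lp_norm \<Omega> p u \<le> K powr (1 / p) * sqrt (grad_norm2 \<Omega> u)"
    proof (rule tendsto_lowerbound)
      show "((\<lambda>N. K powr (1 / p) * sqrt N) \<longlongrightarrow> K powr (1 / p) * sqrt (grad_norm2 \<Omega> u)) (at_right (grad_norm2 \<Omega> u))"
        by (intro tendsto_intros)
      show "\<forall>\<^sub>F N in at_right (grad_norm2 \<Omega> u). Lp_norm \<Omega> p u \<le> K powr (1 / p) * sqrt N"
        using N by (auto simp: eventually_at_filter)
    qed simp
  qed simp
qed

text \<open>The infimum is itself admissible: for a nonzero gradient norm the quotient of the norms
  is a lower bound for all admissible constants, and for gradient norm 0 any one admissible constant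
  already makes the L^p norm vanish.\<close>

lemma Lp_norm_le_Cstar:
  fixes \<Omega> :: "(real^'n) set"
  assumes \<Omega>: "open \<Omega>" "bounded \<Omega>"
    and p: "p > 2" and sub: "p * (real CARD('n) - 2) < 2 * real CARD('n)"
  shows "Cstar \<Omega> p \<ge> 0" and "H01 \<Omega> u \<Longrightarrow> Lp_norm \<Omega> p u \<le> Cstar \<Omega> p * sqrt (grad_norm2 \<Omega> u)"
proof -
  let ?S = "{C. C \<ge> 0 \<and> (\<forall>\<phi>. H01 \<Omega> \<phi> \<longrightarrow> Lp_norm \<Omega> p \<phi> \<le> C * sqrt (grad_norm2 \<Omega> \<phi>))}"
  obtain C0 where C0: "C0 \<in> ?S" using H01_sobolev[OF \<Omega> p sub] by blast
  then have ne: "?S \<noteq> {}" by blast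
  show "Cstar \<Omega> p \<ge> 0" unfolding Cstar_def by (rule cInf_greatest[OF ne]) simp
  assume u: "H01 \<Omega> u"
  have G0: "grad_norm2 \<Omega> u \<ge> 0"
    by (auto simp: grad_norm2_def set_lebesgue_integral_def intro!: Bochner_Integration.integral_nonneg)
  show "Lp_norm \<Omega> p u \<le> Cstar \<Omega> p * sqrt (grad_norm2 \<Omega> u)"
  proof (cases "grad_norm2 \<Omega> u = 0")
    case True then show ?thesis using C0 u by auto
  next
    case False
    then have s: "sqrt (grad_norm2 \<Omega> u) > 0" using G0 by simp
    have "Lp_norm \<Omega> p u / sqrt (grad_norm2 \<Omega> u) \<le> Cstar \<Omega> p" unfolding Cstar_def
    proof (rule cInf_greatest[OF ne])
      fix C assume "C \<in> ?S"
      then show "Lp_norm \<Omega> p u / sqrt (grad_norm2 \<Omega> u) \<le> C" using u s by (auto simp: divide_le_eq)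
    qed
    then show ?thesis using s by (simp add: divide_le_eq)
  qed
qed

section \<open>The differential inequality\<close>

text \<open>The left-hand side solves E' = 2 c E^(p/2) and blows up exactly at T; a subsolution that
  still blows up at T cannot lie below it.\<close>

lemma blowup_lower_bound:
  fixes E D :: "real \<Rightarrow> real" and c p T :: real
  assumes p: "p > 2" and c: "c > 0"
    and E0: "\<And>t. t \<in> {0..<T} \<Longrightarrow> E t \<ge> 0"
    and der: "\<And>t. t \<in> {0..<T} \<Longrightarrow> (E has_real_derivative D t) (at t within {0..<T})"
    and D: "\<And>t. t \<in> {0..<T} \<Longrightarrow> D t \<le> 2 * c * E t powr (p / 2)"
    and blowup: "filterlim E at_top (at_left T)"
    and t: "t \<in> {0..<T}"
  shows "(c * (p - 2) * (T - t)) powr (- 2 / (p - 2)) \<le> E t"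
proof (rule field_le_epsilon)
  fix \<epsilon> :: real assume \<epsilon>: "\<epsilon> > 0"
  \<comment> \<open>Working with \<open>E + \<epsilon>\<close> avoids having to show first that \<open>E\<close> does not vanish.\<close>
  define q where "q = (2 - p) / 2"
  have q: "q < 0" using p by (simp add: q_def)
  define F where "F = (\<lambda>\<tau>. (E \<tau> + \<epsilon>) powr q + c * (p - 2) * \<tau>)"
  have pos: "E \<tau> + \<epsilon> > 0" if "\<tau> \<in> {0..<T}" for \<tau> using E0[OF that] \<epsilon> by simp
  have dF: "(F has_real_derivative q * (E \<tau> + \<epsilon>) powr (q - 1) * D \<tau> + c * (p - 2)) (at \<tau> within {0..<T})"
    if \<tau>: "\<tau> \<in> {0..<T}" for \<tau>
  proof -
    have "((\<lambda>\<tau>. E \<tau> + \<epsilon>) has_real_derivative D \<tau>) (at \<tau> within {0..<T})"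
      using der[OF \<tau>] by (auto intro!: derivative_eq_intros)
    from DERIV_chain2[where f="\<lambda>z. z powr q" and g="\<lambda>\<tau>. E \<tau> + \<epsilon>", OF has_real_derivative_powr[OF pos[OF \<tau>]] this]
    show ?thesis unfolding F_def
      by (rule DERIV_add) (auto intro!: derivative_eq_intros)
  qed
  \<comment> \<open>Since q - 1 + p/2 = 0, the powers of E + \<epsilon> cancel, and the negative
    sign of q reverses the differential inequality into the constant lower bound -c (p - 2).\<close>
  have F'0: "q * (E \<tau> + \<epsilon>) powr (q - 1) * D \<tau> + c * (p - 2) \<ge> 0" if \<tau>: "\<tau> \<in> {0..<T}" for \<tau>
  proof -
    have "D \<tau> \<le> 2 * c * E \<tau> powr (p / 2)" by (rule D[OF \<tau>])
    also have "\<dots> \<le> 2 * c * (E \<tau> + \<epsilon>) powr (p / 2)"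
      using c p E0[OF \<tau>] \<epsilon> by (intro mult_left_mono powr_mono2) auto
    finally have "(E \<tau> + \<epsilon>) powr (q - 1) * D \<tau> \<le> (E \<tau> + \<epsilon>) powr (q - 1) * (2 * c * (E \<tau> + \<epsilon>) powr (p / 2))"
      by (intro mult_left_mono) auto
    also have "\<dots> = 2 * c * ((E \<tau> + \<epsilon>) powr (q - 1) * (E \<tau> + \<epsilon>) powr (p / 2))" by (simp only: mult_ac)
    also have "(E \<tau> + \<epsilon>) powr (q - 1) * (E \<tau> + \<epsilon>) powr (p / 2) = 1"
    proof -
      have "q - 1 + p / 2 = 0" by (simp add: q_def field_simps)
      then show ?thesis using pos[OF \<tau>] by (simp add: powr_add[symmetric])
    qed
    finally have "(E \<tau> + \<epsilon>) powr (q - 1) * D \<tau> \<le> 2 * c" by simp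
    then have "q * ((E \<tau> + \<epsilon>) powr (q - 1) * D \<tau>) \<ge> q * (2 * c)" using q by (intro mult_left_mono_neg) auto
    moreover have "q * (2 * c) = - (c * (p - 2))" by (simp add: q_def field_simps)
    ultimately show ?thesis by (simp add: mult.assoc)
  qed
  \<comment> \<open>The derivative at time 0 is only one-sided, hence the monotonicity criterion
    with interior derivatives and continuity up to the endpoints.\<close>
  have mono: "F t \<le> F \<tau>" if \<tau>: "t \<le> \<tau>" "\<tau> < T" for \<tau>
  proof (rule DERIV_nonneg_imp_increasing_open[OF \<tau>(1)])
    fix x assume x: "t < x" "x < \<tau>"
    then have x1: "x \<in> {0..<T}" "x \<in> {0<..<T}" using t \<tau> by auto
    have "(F has_real_derivative q * (E x + \<epsilon>) powr (q - 1) * D x + c * (p - 2)) (at x)"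
      using dF[OF x1(1)] x1(2) by (subst (asm) at_within_interior) auto
    then show "\<exists>y. DERIV F x :> y \<and> y \<ge> 0" using F'0[OF x1(1)] by blast
  next
    show "continuous_on {t..\<tau>} F"
      using t \<tau> by (intro continuous_on_subset[OF DERIV_continuous_on[OF dF]]) auto
  qed
  have "F t \<le> 0 + c * (p - 2) * T"
  proof (rule tendsto_lowerbound)
    have "filterlim (\<lambda>\<tau>. E \<tau> + \<epsilon>) at_top (at_left T)"
      using filterlim_tendsto_add_at_top[OF tendsto_const[of \<epsilon>] blowup] by (simp add: add.commute)
    then show "(F \<longlongrightarrow> 0 + c * (p - 2) * T) (at_left T)" unfolding F_def
      by (intro tendsto_add tendsto_neg_powr[OF q] tendsto_intros)
    show "\<forall>\<^sub>F \<tau> in at_left T. F t \<le> F \<tau>"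
      using t mono by (auto simp: eventually_at_left[of t T] intro!: exI[of _ t])
  qed simp
  then have le: "(E t + \<epsilon>) powr q \<le> c * (p - 2) * (T - t)" unfolding F_def by (simp add: algebra_simps)
  \<comment> \<open>The exponent 1 / q is negative and reverses the order; the smaller base is
    positive because E + \<epsilon> is.\<close>
  have "(c * (p - 2) * (T - t)) powr (1 / q) \<le> ((E t + \<epsilon>) powr q) powr (1 / q)"
    using le q pos[OF t] by (intro powr_mono2') auto
  also have "\<dots> = E t + \<epsilon>" using q pos[OF t] by (simp add: powr_powr)
  finally show "(c * (p - 2) * (T - t)) powr (- 2 / (p - 2)) \<le> E t + \<epsilon>"
  proof -
    have "1 / q = - 2 / (p - 2)" using p by (simp add: q_def field_simps)
    then show "(c * (p - 2) * (T - t)) powr (1 / q) \<le> E t + \<epsilon> \<Longrightarrow> ?thesis" by simp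
  qed
qed

section \<open>The energy and the blow-up bounds\<close>

lemma energy_nonneg: "energy \<Omega> s v \<ge> 0" "grad_norm2 \<Omega> v \<ge> 0" "grad_norm2 \<Omega> v \<le> energy \<Omega> s v"
proof -
  have "wL2 \<Omega> s v \<ge> 0"
    by (auto simp: wL2_def set_lebesgue_integral_def intro!: Bochner_Integration.integral_nonneg)
  moreover show "grad_norm2 \<Omega> v \<ge> 0"
    by (auto simp: grad_norm2_def set_lebesgue_integral_def intro!: Bochner_Integration.integral_nonneg)
  ultimately show "energy \<Omega> s v \<ge> 0" "grad_norm2 \<Omega> v \<le> energy \<Omega> s v" by (auto simp: energy_def)
qed

text \<open>The initial value is attained only almost everywhere, while the bound on T is stated
  with \<open>u0\<close>. Functions equal almost everywhere have the same weak gradients, so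
  \<open>SOME\<close> returns literally the same one for both.\<close>

lemma energy_cong_AE:
  fixes \<Omega> :: "(real^'n) set"
  assumes \<Omega>: "open \<Omega>" and m: "v \<in> borel_measurable borel" "w \<in> borel_measurable borel"
    and ae: "AE x in lborel. x \<in> \<Omega> \<longrightarrow> v x = w x"
  shows "energy \<Omega> s v = energy \<Omega> s w"
proof -
  have [measurable]: "v \<in> borel_measurable borel" "w \<in> borel_measurable borel" "\<Omega> \<in> sets borel" using m \<Omega> by auto
  have "weak_grad \<Omega> v g \<longleftrightarrow> weak_grad \<Omega> w g" for g
  proof -
    have "(LINT x:\<Omega>|lborel. v x *\<^sub>R D\<phi> x) = (LINT x:\<Omega>|lborel. w x *\<^sub>R D\<phi> x)" if t: "is_test \<Omega> \<phi> D\<phi>" for \<phi> D\<phi>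
    proof (rule set_lebesgue_integral_cong_AE)
      have [measurable]: "D\<phi> \<in> borel_measurable borel" using is_test_borel[OF t] by auto
      show "(\<lambda>x. v x *\<^sub>R D\<phi> x) \<in> borel_measurable lborel" "(\<lambda>x. w x *\<^sub>R D\<phi> x) \<in> borel_measurable lborel" by measurable
      show "AE x\<in>\<Omega> in lborel. v x *\<^sub>R D\<phi> x = w x *\<^sub>R D\<phi> x" using ae by eventually_elim auto
    qed simp
    then show ?thesis unfolding weak_grad_def by (simp cong: imp_cong)
  qed
  then have "grad_norm2 \<Omega> v = grad_norm2 \<Omega> w" by (simp add: grad_norm2_def wgrad_def)
  moreover have "wL2 \<Omega> s v = wL2 \<Omega> s w" unfolding wL2_def
  proof (rule set_lebesgue_integral_cong_AE)
    show "AE x\<in>\<Omega> in lborel. (v x)\<^sup>2 / norm x powr s = (w x)\<^sup>2 / norm x powr s" using ae by eventually_elim auto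
  qed auto
  ultimately show ?thesis by (simp add: energy_def)
qed

theorem theorem3p2:
  fixes \<Omega> :: "(real^'n) set" and s p T :: real
    and u0 :: "real^'n \<Rightarrow> real" and u :: "real \<Rightarrow> real^'n \<Rightarrow> real"
  assumes dim: "CARD('n) > 2"
    and dom: "bounded_smooth_domain \<Omega>"
    and s: "0 \<le> s" "s \<le> 2"
    and p: "2 < p" "p < 2 * real CARD('n) / (real CARD('n) - 2)"
    and u0: "H01 \<Omega> u0"
    and T: "0 < T"
    and sol: "maximal_weak_sol \<Omega> s p u0 T u"
    and E2: "\<forall>t\<in>{0..<T}. ((\<lambda>\<tau>. energy \<Omega> s (u \<tau>)) has_real_derivative
                 (- 2 * Ifun \<Omega> p (u t))) (at t within {0..<T})"
    and blowup: "filterlim (\<lambda>t. energy \<Omega> s (u t)) at_top (at_left T)"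
  shows "T \<ge> 1 / (Cstar \<Omega> p powr p * (p - 2)) * energy \<Omega> s u0 powr ((2 - p) / 2) \<and>
     (\<forall>t\<in>{0..<T}. energy \<Omega> s (u t) \<ge>
           1 / (Cstar \<Omega> p powr (2 * p / (p - 2)) * (p - 2) powr (2 / (p - 2)))
             * (T - t) powr (- 2 / (p - 2)))"
proof (cases "Cstar \<Omega> p = 0")
  \<comment> \<open>Both right-hand sides are 0 here, since \<open>0 powr a = 0\<close> and division
    by 0 yields 0.\<close>
  case True
  then show ?thesis using T by (simp add: energy_nonneg(1))
next
  case C0: False
  have \<Omega>: "open \<Omega>" "bounded \<Omega>" using dom by (auto simp: bounded_smooth_domain_def)
  have sub: "p * (real CARD('n) - 2) < 2 * real CARD('n)"
    using p(2) dim by (simp add: less_divide_eq)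
  define C where "C = Cstar \<Omega> p"
  have C: "C > 0" using Lp_norm_le_Cstar(1)[OF \<Omega> p(1) sub] C0 by (simp add: C_def)
  define c where "c = C powr p"
  have c: "c > 0" using C by (simp add: c_def)
  obtain ut where ws: "weak_sol_with \<Omega> s p u0 T u ut"
    using sol by (auto simp: maximal_weak_sol_def weak_sol_def)
  have H: "H01 \<Omega> (u t)" if "t \<in> {0..<T}" for t using ws that by (simp add: weak_sol_with_def)
  have "AE x in lborel. x \<in> \<Omega> \<longrightarrow> u 0 x = u0 x" using ws by (simp add: weak_sol_with_def)
  then have e0: "energy \<Omega> s (u 0) = energy \<Omega> s u0"
    using H[of 0] T u0 by (intro energy_cong_AE \<Omega>(1)) (auto simp: H01_def L2_def)
  \<comment> \<open>In -2 I the gradient term is nonpositive and is dropped; the Sobolev bound on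
    the remaining L^p term is then enlarged by replacing the gradient norm with the full
    energy.\<close>
  have D: "- 2 * Ifun \<Omega> p (u t) \<le> 2 * c * energy \<Omega> s (u t) powr (p / 2)" if t: "t \<in> {0..<T}" for t
  proof -
    have "Lp_norm \<Omega> p (u t) powr p \<le> (C * sqrt (grad_norm2 \<Omega> (u t))) powr p"
      using Lp_norm_le_Cstar(2)[OF \<Omega> p(1) sub H[OF t]] p unfolding C_def
      by (intro powr_mono2) (auto simp: Lp_norm_def)
    also have "\<dots> = c * grad_norm2 \<Omega> (u t) powr (p / 2)"
      using C energy_nonneg(2)[of \<Omega> "u t"]
      by (simp add: c_def powr_mult powr_half_sqrt[symmetric] powr_powr)
    also have "\<dots> \<le> c * energy \<Omega> s (u t) powr (p / 2)"
      using c p by (intro mult_left_mono powr_mono2 energy_nonneg(2,3)) auto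
    finally show ?thesis using energy_nonneg(2)[of \<Omega> "u t"] by (simp add: Ifun_def)
  qed
  have low: "(c * (p - 2) * (T - t)) powr (- 2 / (p - 2)) \<le> energy \<Omega> s (u t)" if "t \<in> {0..<T}" for t
    by (rule blowup_lower_bound[where T=T and D="\<lambda>t. - 2 * Ifun \<Omega> p (u t)"])
       (use p c E2 D blowup that in \<open>auto simp: energy_nonneg\<close>)
  show ?thesis
  proof (intro conjI ballI)
    define Q where "Q = c * (p - 2) * T"
    have Q: "Q > 0" using c p T by (simp add: Q_def)
    \<comment> \<open>The bound on T is the pointwise bound at time 0, inverted by the decreasing
      power (2 - p) / 2.\<close>
    have "Q powr (- 2 / (p - 2)) \<le> energy \<Omega> s u0" using low[of 0] T e0 by (simp add: Q_def)
    then have "energy \<Omega> s u0 powr ((2 - p) / 2) \<le> (Q powr (- 2 / (p - 2))) powr ((2 - p) / 2)"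
      using Q p by (intro powr_mono2') auto
    also have "\<dots> = Q powr ((- 2 / (p - 2)) * ((2 - p) / 2))" by (simp only: powr_powr)
    also have "(- 2 / (p - 2)) * ((2 - p) / 2) = 1" using p by (simp add: field_simps)
    finally have "energy \<Omega> s u0 powr ((2 - p) / 2) \<le> c * (p - 2) * T" using Q by (simp add: Q_def)
    then show "T \<ge> 1 / (Cstar \<Omega> p powr p * (p - 2)) * energy \<Omega> s u0 powr ((2 - p) / 2)"
      using c p unfolding C_def[symmetric] c_def[symmetric] by (simp add: divide_le_eq mult_ac)
  next
    fix t assume t: "t \<in> {0..<T}"
    have "(c * (p - 2) * (T - t)) powr (- 2 / (p - 2))
        = c powr (- 2 / (p - 2)) * (p - 2) powr (- 2 / (p - 2)) * (T - t) powr (- 2 / (p - 2))"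
      using c p t by (simp only: powr_mult)
    also have "c powr (- 2 / (p - 2)) = 1 / C powr (2 * p / (p - 2))"
      unfolding c_def powr_powr by (simp add: powr_minus_divide[symmetric] mult_ac)
    also have "(p - 2) powr (- 2 / (p - 2)) = 1 / (p - 2) powr (2 / (p - 2))"
      by (simp add: powr_minus_divide[symmetric])
    finally show "energy \<Omega> s (u t) \<ge>
           1 / (Cstar \<Omega> p powr (2 * p / (p - 2)) * (p - 2) powr (2 / (p - 2)))
             * (T - t) powr (- 2 / (p - 2))"
      using low[OF t] unfolding C_def by simp
  qed
qed

end
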